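(* Let $X\subset\mathbb{R}^D$ and $f:X\to X$ be as in the context (an injective, non-singular, piecewise $C^1$-diffeomorphism with singular set $\Delta$), and let $\varepsilon\in(0,1)$. Let $0<\lambda<(1-\varepsilon)^{-1}$ and suppose that $|\det f'(x)|^{-1}\leq\lambda$ for all $x\in X\setminus\Delta$. Then $h_\varepsilon$ is continuous in $\Lambda$ (i.e. at every point of $\Lambda$, as a function on $X$). Moreover, for every $z\in\Lambda$ and $\tau>0$, setting $y=-\ln\tau$ and $u_n=\frac{y}{a_n}+b_n$ with $a_n=D$ and $b_n$ such that $$m(B(z,e^{-b_n}))=\frac{1}{n\,h_\varepsilon(z)}\qquad\forall\,n\in\mathbb{N},\ n\ge1,$$ one has, with $Y_0(x)=-\log d(x,z)$, $$\lim_{n\to\infty}n\,\mathbb{P}(Y_0>u_n)=\tau.$$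
   Context: The map. $X\subset\mathbb{R}^D$ is compact with $X=\overline{\mathrm{int}(X)}$, $m$ is Lebesgue measure on $\mathbb{R}^D$ normalized so that $m(X)=1$, and $d$ is the metric induced by a norm on $\mathbb{R}^D$; $B(z,r)$ is the ball in $\mathbb{R}^D$ of center $z$ and radius $r$ for this metric. $\{X_i\}_{i=1}^N$ is a collection of disjoint open sets (open in $\mathbb{R}^D$) contained in $X$ with $X=\bigcup_{i=1}^N\overline{X_i}$ and $m(\Delta)=0$, where $\Delta:=X\setminus\bigcup_{i=1}^N X_i$ is the singular set. The map $f:X\to X$ is non-singular with respect to $m$, injective on $X$, and $f|_{X\setminus\Delta}$ is a $C^1$-diffeomorphism onto its image. Notation. $\Lambda_0:=X$, $\Lambda_{k+1}:=f(\Lambda_k\setminus\Delta)$ for $k\ge0$, and $\Lambda:=\bigcap_{k\ge1}\Lambda_k$. $J_0:=1$ and, for $k\ge1$ and $x\in\Lambda_k$, $J_k(x):=\prod_{l=1}^k|\det f'(f^{-l}(x))|^{-1}$. The function $h_\varepsilon$ is $h_\varepsilon(x)=\varepsilon\sum_{k=0}^\infty(1-\varepsilon)^kJ_k(x)\mathbf 1_{\Lambda_k}(x)$, $x\in X$ (the $k$-th term being $0$ for $x\notin\Lambda_k$). Randomly applied stochastic perturbation. Let $\Omega_\varepsilon=\{0,1\}\times X$ and let $\theta_\varepsilon$ be the product of the Bernoulli measure with weights $(\varepsilon,1-\varepsilon)$ on $\{0,1\}$ (so $0$ has probability $\varepsilon$) and the uniform measure $m$ on $X$. For $\omega=(\eta,\xi)\in\Omega_\varepsilon$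 put $f_\omega(x)=\eta f(x)+(1-\eta)\xi$. Let $\mu_\varepsilon$ be the absolutely continuous stationary probability measure, i.e. $\mu_\varepsilon(A)=\int_X\int_{\Omega_\varepsilon}\mathbf 1_A(f_\omega(x))\,d\theta_\varepsilon(\omega)\,d\mu_\varepsilon(x)$ for all measurable $A\subset X$; $\mu_\varepsilon=h_\varepsilon m$. Put $\mathbb{P}=\mu_\varepsilon\times\theta_\varepsilon^{\mathbb{N}}$ on $X\times\Omega_\varepsilon^{\mathbb{N}}$; $\mathbb{P}(Y_0>u)=\mu_\varepsilon(\{x: -\log d(x,z)>u\})$. *)

theory Defs
  imports "HOL-Probability.Probability"
begin

text \<open>The metric on the state space comes from an arbitrary norm, not necessarily the Euclidean
  norm of the type class.\<close>

definition is_norm :: "('a::real_vector \<Rightarrow> real) \<Rightarrow> bool" where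
  "is_norm nrm \<longleftrightarrow>
     (\<forall>x. nrm x = 0 \<longleftrightarrow> x = 0) \<and>
     (\<forall>c x. nrm (c *\<^sub>R x) = \<bar>c\<bar> * nrm x) \<and>
     (\<forall>x y. nrm (x + y) \<le> nrm x + nrm y)"

definition ndist :: "('a::real_vector \<Rightarrow> real) \<Rightarrow> 'a \<Rightarrow> 'a \<Rightarrow> real" where
  "ndist nrm x y = nrm (x - y)"

definition nball :: "('a::real_vector \<Rightarrow> real) \<Rightarrow> 'a \<Rightarrow> real \<Rightarrow> 'a set" where
  "nball nrm z r = {x. ndist nrm z x < r}"

text \<open>Intended for open \<open>U\<close>, so that \<^term>\<open>at x\<close> involves only values of \<open>f\<close> on \<open>U\<close>.\<close>

definition C1_on ::
    "('a::real_normed_vector \<Rightarrow> 'b::real_normed_vector) \<Rightarrow> 'a set \<Rightarrow> bool" where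
  "C1_on f U \<longleftrightarrow>
     (\<exists>f'. (\<forall>x\<in>U. (f has_derivative blinfun_apply (f' x)) (at x)) \<and> continuous_on U f')"

definition C1_diffeo_onto_image ::
    "('a::real_normed_vector \<Rightarrow> 'b::real_normed_vector) \<Rightarrow> 'a set \<Rightarrow> bool" where
  "C1_diffeo_onto_image f U \<longleftrightarrow>
     open U \<and> open (f ` U) \<and> inj_on f U \<and> C1_on f U \<and> C1_on (inv_into U f) (f ` U)"

definition non_singular :: "'a measure \<Rightarrow> ('a \<Rightarrow> 'a) \<Rightarrow> bool" where
  "non_singular M f \<longleftrightarrow>
     f \<in> measurable M M \<and> (\<forall>A\<in>null_sets M. f -` A \<inter> space M \<in> null_sets M)"

definition jacobian :: "(real^'n \<Rightarrow> real^'n) \<Rightarrow> real^'n \<Rightarrow> real" where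
  "jacobian f x = det (matrix (frechet_derivative f (at x)))"

definition singular_set :: "'a set \<Rightarrow> nat \<Rightarrow> (nat \<Rightarrow> 'a set) \<Rightarrow> 'a set" where
  "singular_set X N U = X - (\<Union>i\<in>{1..N}. U i)"

text \<open>The parameter \<open>S\<close> is the singular set.\<close>

primrec Lam :: "'a set \<Rightarrow> 'a set \<Rightarrow> ('a \<Rightarrow> 'a) \<Rightarrow> nat \<Rightarrow> 'a set" where
  "Lam X S f 0 = X"
| "Lam X S f (Suc k) = f ` (Lam X S f k - S)"

definition Lam_inf :: "'a set \<Rightarrow> 'a set \<Rightarrow> ('a \<Rightarrow> 'a) \<Rightarrow> 'a set" where
  "Lam_inf X S f = (\<Inter>k\<in>{1..}. Lam X S f k)"

text \<open>Meaningful for \<open>x\<close> in \<^term>\<open>Lam X S f k\<close>: there the first \<open>k\<close> preimages of \<open>x\<close>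
  under the injective map \<open>f\<close> exist and avoid \<open>S\<close>.\<close>

definition J :: "(real^'n) set \<Rightarrow> (real^'n \<Rightarrow> real^'n) \<Rightarrow> nat \<Rightarrow> real^'n \<Rightarrow> real" where
  "J X f k x = (\<Prod>l=1..k. inverse \<bar>jacobian f ((inv_into X f ^^ l) x)\<bar>)"

definition h_eps :: "(real^'n) set \<Rightarrow> (real^'n) set \<Rightarrow> (real^'n \<Rightarrow> real^'n) \<Rightarrow> real
    \<Rightarrow> real^'n \<Rightarrow> real" where
  "h_eps X S f \<epsilon> x = \<epsilon> * (\<Sum>k. (1 - \<epsilon>) ^ k * (J X f k x * indicator (Lam X S f k) x))"

text \<open>A measure on the whole space, normalized so that \<open>X\<close> has mass one; balls
  are not required to lie inside \<open>X\<close>.\<close>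

definition nleb :: "(real^'n) set \<Rightarrow> (real^'n) measure" where
  "nleb X = scale_measure (inverse (emeasure lebesgue X)) lebesgue"

definition unif :: "(real^'n) set \<Rightarrow> (real^'n) measure" where
  "unif X = restrict_space (nleb X) X"

text \<open>The set \<open>{0,1}\<close> is encoded by \<^typ>\<open>bool\<close>, with \<^term>\<open>False\<close> for \<open>0\<close>
  (probability \<open>\<epsilon>\<close>) and \<^term>\<open>True\<close> for \<open>1\<close> (probability \<open>1 - \<epsilon>\<close>).\<close>

definition theta :: "(real^'n) set \<Rightarrow> real \<Rightarrow> (bool \<times> (real^'n)) measure" where
  "theta X \<epsilon> = measure_pmf (bernoulli_pmf (1 - \<epsilon>)) \<Otimes>\<^sub>M unif X"

definition rmap :: "(real^'n \<Rightarrow> real^'n) \<Rightarrow> bool \<times> (real^'n) \<Rightarrow> real^'n \<Rightarrow> real^'n" where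
  "rmap f \<omega> x = (case \<omega> of (\<eta>, \<xi>) \<Rightarrow>
     of_bool \<eta> *\<^sub>R f x + (1 - of_bool \<eta>) *\<^sub>R \<xi>)"

definition acs_prob_measure :: "(real^'n) set \<Rightarrow> (real^'n \<Rightarrow> real^'n) \<Rightarrow> real
    \<Rightarrow> (real^'n) measure \<Rightarrow> bool" where
  "acs_prob_measure X f \<epsilon> \<mu> \<longleftrightarrow>
     prob_space \<mu> \<and> sets \<mu> = sets (unif X) \<and> absolutely_continuous (unif X) \<mu> \<and>
     (\<forall>A\<in>sets (unif X).
        emeasure \<mu> A = (\<integral>\<^sup>+x. (\<integral>\<^sup>+\<omega>. indicator A (rmap f \<omega> x) \<partial>theta X \<epsilon>) \<partial>\<mu>))"

definition path_measure :: "(real^'n) set \<Rightarrow> real \<Rightarrow> (real^'n) measure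
    \<Rightarrow> ((real^'n) \<times> (nat \<Rightarrow> bool \<times> (real^'n))) measure" where
  "path_measure X \<epsilon> \<mu> = \<mu> \<Otimes>\<^sub>M (\<Pi>\<^sub>M i\<in>(UNIV::nat set). theta X \<epsilon>)"

text \<open>Extended-real valued because \<open>- log 0\<close> is \<open>\<infinity>\<close>, whereas \<^term>\<open>ln (0::real)\<close> is \<open>0\<close>.\<close>

definition Y0 :: "('a::real_vector \<Rightarrow> real) \<Rightarrow> 'a \<Rightarrow> 'a \<Rightarrow> ereal" where
  "Y0 nrm z x = (if x = z then \<infinity> else ereal (- ln (ndist nrm x z)))"

end

theory Submission
  imports Defs
begin

text \<open>Write \<open>T\<close> for the inverse of \<open>f\<close>, \<open>\<Lambda> k\<close> for the set \<open>Lam X S f k\<close> and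
\<open>h\<close> for \<open>h_eps X S f \<epsilon>\<close>.

\<^emph>\<open>Continuity.\<close> Since \<open>f\<close> is a diffeomorphism of the open set \<open>X - S\<close> onto an open set,
every \<open>\<Lambda> k\<close> with \<open>k \<ge> 1\<close> is open, \<open>T\<close> maps \<open>\<Lambda> (k + 1)\<close> into \<open>\<Lambda> k - S\<close>, and
\<open>J k\<close> is continuous on \<open>\<Lambda> k\<close>. A point of \<open>\<Lambda>\<close> therefore has, for each \<open>k\<close>, a neighbourhood in
\<open>X\<close> on which the indicator in the \<open>k\<close>-th term of \<open>h\<close> is constantly 1, and every term is
continuous at that point. The \<open>k\<close>-th term is at most \<open>((1 - \<epsilon>) lam)^k\<close>, the general term of a
convergent geometric series, so the sum is continuous there too (\<open>continuous_h\<close>).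

\<^emph>\<open>The stationary measure has density \<open>h\<close>.\<close> Stationarity says
\<open>\<mu> A = \<epsilon> m A + (1 - \<epsilon>) \<mu> (f\<^sup>-\<^sup>1 A)\<close>. Iterating this, and discarding the null set of points whose
orbit meets \<open>S\<close>, gives \<open>\<mu> A = (\<Sum>k. \<epsilon> (1 - \<epsilon>)^k m (T^k (A \<inter> \<Lambda> k)))\<close>: the sum runs over the time
\<open>k\<close> elapsed since the last uniformly distributed jump. The map \<open>T^k\<close> is differentiable and
injective on \<open>\<Lambda> k\<close> with Jacobian \<open>J k\<close> by the chain rule, so for open \<open>A\<close> the change of variables
formula turns the \<open>k\<close>-th measure into the integral of \<open>J k\<close> over \<open>A \<inter> \<Lambda> k\<close>, and the series into the
integral of \<open>h\<close> over \<open>A\<close> (\<open>emeasure_\<mu>_eq_integral_h\<close>). Open sets suffice because the only sets to be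
measured are small balls around a point of \<open>\<Lambda>\<close>.

\<^emph>\<open>The limit.\<close> The event \<open>Y\<^sub>0 > u\<^sub>n\<close> is the ball of radius \<open>exp (- u\<^sub>n)\<close> about \<open>z\<close>. A norm ball of
radius \<open>r\<close> has measure \<open>\<kappa> r^D\<close>, and \<open>u\<^sub>n\<close> is chosen so that this radius is \<open>\<tau>^(1/D)\<close> times that of
the ball of measure \<open>1 / (n h(z))\<close>; hence the ball has measure \<open>\<tau> / (n h(z))\<close>, and its radius tends
to 0 because \<open>h(z) \<ge> \<epsilon> > 0\<close>. Continuity of \<open>h\<close> at \<open>z\<close> makes \<open>\<mu>\<close> of the ball asymptotic to \<open>h(z)\<close>
times its measure (\<open>\<mu>_density_at_Lam_inf\<close>), that is, to \<open>\<tau> / n\<close>.\<close>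

section \<open>Change of variables over an unordered index type\<close>

text \<open>The change of variables theorem is stated for \<open>real^'n\<close> with a well-ordered index type, whereas the
index type of the dynamical system is an arbitrary finite type. A copy of that type, ordered by an
arbitrary enumeration, carries the theorem over: permuting coordinates preserves Lebesgue measure
and conjugates the derivative by a permutation matrix, so both sides of the formula are unchanged.\<close>
typedef 'a well_ordered = "UNIV :: 'a set"
  by simp

lemma bij_Rep_well_ordered: "bij Rep_well_ordered"
  by (rule bijI, simp add: inj_on_def Rep_well_ordered_inject, rule surjI[of _ Abs_well_ordered])
    (simp add: Abs_well_ordered_inverse)

instance well_ordered :: (finite) finite
proof
  show "finite (UNIV :: 'a well_ordered set)"
    using bij_betw_finite[OF bij_Rep_well_ordered[where 'a = 'a]] by simp
qed

definition well_ordered_rank :: "'a::finite well_ordered \<Rightarrow> nat" where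
  "well_ordered_rank = (SOME g. inj g)"

lemma inj_well_ordered_rank: "inj (well_ordered_rank :: 'a::finite well_ordered \<Rightarrow> nat)"
proof -
  have "\<exists>g :: 'a well_ordered \<Rightarrow> nat. inj g"
    using finite_imp_inj_to_nat_seg[of "UNIV :: 'a well_ordered set"] by auto
  thus ?thesis
    unfolding well_ordered_rank_def by (rule someI_ex)
qed

instantiation well_ordered :: (finite) wellorder
begin

definition "a \<le> b \<longleftrightarrow> well_ordered_rank a \<le> well_ordered_rank b"
definition "a < b \<longleftrightarrow> well_ordered_rank a < well_ordered_rank b"

instance
proof
  fix P :: "'a well_ordered \<Rightarrow> bool" and a
  assume step: "\<And>x. (\<And>y. y < x \<Longrightarrow> P y) \<Longrightarrow> P x"
  show "P a"
  proof (induction a rule: measure_induct_rule[of well_ordered_rank])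
    case (less x)
    show ?case
      by (rule step) (rule less, simp add: less_well_ordered_def)
  qed
next
  fix a b :: "'a well_ordered"
  assume "a \<le> b" "b \<le> a"
  hence "well_ordered_rank a = well_ordered_rank b"
    by (simp add: less_eq_well_ordered_def)
  thus "a = b"
    by (rule injD[OF inj_well_ordered_rank])
qed (auto simp: less_eq_well_ordered_def less_well_ordered_def)

end

definition reindex :: "('m \<Rightarrow> 'n) \<Rightarrow> 'a ^ 'n \<Rightarrow> 'a ^ 'm" where
  "reindex \<phi> v = (\<chi> i. v $ \<phi> i)"

lemma linear_reindex: "linear (reindex \<phi> :: real ^ 'n \<Rightarrow> real ^ 'm)"
  by (rule linearI) (simp_all add: reindex_def vec_eq_iff)

lemma reindex_axis:
  assumes "bij \<phi>"
  shows "reindex \<phi> (axis (\<phi> i) c) = axis i c"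
  using assms by (auto simp: reindex_def axis_def vec_eq_iff bij_def inj_on_def)

text \<open>Conjugation by \<open>\<phi>\<close> is a sign-preserving bijection between the permutations of the two index types,
and it matches the terms of the two Leibniz expansions.\<close>
lemma det_reindex:
  fixes A :: "real ^ 'n ^ 'n" and \<phi> :: "'m::finite \<Rightarrow> 'n"
  assumes \<phi>: "bij \<phi>"
  shows "det (\<chi> i j. A $ \<phi> i $ \<phi> j) = det A"
proof -
  let ?c = "map_permutation UNIV \<phi>"
  have c: "?c p (\<phi> i) = \<phi> (p i)" for p i
    using \<phi> by (auto simp: map_permutation_def restrict_id_def bij_def)
  have inj: "inj \<phi>" and surj: "surj \<phi>"
    using \<phi> by (auto simp: bij_def)
  have inv_bij: "bij (inv \<phi>)"
    using \<phi> by (rule bij_imp_bij_inv)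
  have bij: "bij_betw ?c {p. p permutes UNIV} {q. q permutes UNIV}"
  proof (rule bij_betw_byWitness[where f' = "map_permutation UNIV (inv \<phi>)"])
    show "\<forall>p\<in>{p. p permutes UNIV}. map_permutation UNIV (inv \<phi>) (?c p) = p"
      using \<phi> inj by (auto intro: map_permutation_compose_inv)
    show "\<forall>p\<in>{p. p permutes UNIV}. ?c (map_permutation UNIV (inv \<phi>) p) = p"
      using inv_bij surj by (auto intro!: map_permutation_compose_inv simp: surj_f_inv_f)
    show "?c ` {p. p permutes UNIV} \<subseteq> {q. q permutes UNIV}"
      using \<phi> by (auto intro!: map_permutation_permutes)
    show "map_permutation UNIV (inv \<phi>) ` {p. p permutes UNIV} \<subseteq> {q. q permutes UNIV}"
      using inv_bij by (auto intro!: map_permutation_permutes)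
  qed
  have prod: "(\<Prod>i\<in>UNIV. A $ i $ ?c p i) = (\<Prod>i\<in>UNIV. A $ \<phi> i $ \<phi> (p i))" for p
    using prod.reindex_bij_betw[OF \<phi>, of "\<lambda>i. A $ i $ ?c p i"] by (simp add: c)
  show ?thesis
    unfolding det_def
    by (subst sum.reindex_bij_betw[OF bij, symmetric])
      (auto intro!: sum.cong simp: prod sign_map_permutation[OF inj])
qed

lemma bij_reindex:
  assumes "bij \<phi>"
  shows "reindex (inv \<phi>) (reindex \<phi> v) = v" "reindex \<phi> (reindex (inv \<phi>) w) = w"
  using assms by (auto simp: reindex_def vec_eq_iff bij_def surj_f_inv_f)

lemma det_matrix_reindex:
  fixes L :: "real ^ 'n \<Rightarrow> real ^ 'n" and \<phi> :: "'m::finite \<Rightarrow> 'n"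
  assumes \<phi>: "bij \<phi>"
  shows "det (matrix (reindex \<phi> \<circ> L \<circ> reindex (inv \<phi>))) = det (matrix L)"
proof -
  have "reindex (inv \<phi>) (axis j (1::real)) = axis (\<phi> j) 1" for j
    using reindex_axis[OF bij_imp_bij_inv[OF \<phi>], of "\<phi> j" "1::real"] \<phi> by (simp add: bij_def)
  hence "matrix (reindex \<phi> \<circ> L \<circ> reindex (inv \<phi>)) = (\<chi> i j. matrix L $ \<phi> i $ \<phi> j)"
    by (simp add: matrix_def reindex_def vec_eq_iff)
  thus ?thesis
    by (simp add: det_reindex[OF \<phi>])
qed

text \<open>The preimage of a box is the box with permuted corners, which has the same side lengths.\<close>
lemma lborel_reindex:
  fixes \<phi> :: "'m::finite \<Rightarrow> 'n::finite"
  assumes \<phi>: "bij \<phi>"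
  shows "distr lborel borel (reindex \<phi> :: real ^ 'n \<Rightarrow> real ^ 'm) = lborel"
proof (rule lborel_eqI[symmetric])
  let ?r = "reindex \<phi> :: real ^ 'n \<Rightarrow> real ^ 'm"
  have [measurable]: "?r \<in> borel_measurable borel"
    by (intro borel_measurable_continuous_onI linear_continuous_on linear_conv_bounded_linear[THEN iffD1] linear_reindex)
  fix l u :: "real ^ 'm"
  assume le: "\<And>b. b \<in> Basis \<Longrightarrow> l \<bullet> b \<le> u \<bullet> b"
  have vimage: "?r -` box l u = box (reindex (inv \<phi>) l) (reindex (inv \<phi>) u)"
    using \<phi> by (auto simp: mem_box_cart reindex_def bij_def) (metis surj_f_inv_f inv_f_f)+
  have comp: "l $ i \<le> u $ i" for i
    using le[of "axis i 1"] by (simp add: inner_axis axis_in_Basis_iff)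
  have le': "reindex (inv \<phi>) l \<bullet> b \<le> reindex (inv \<phi>) u \<bullet> b" if "b \<in> Basis" for b
    using that comp by (auto simp: Basis_vec_def inner_axis reindex_def)
  have prodB: "(\<Prod>b\<in>Basis. v \<bullet> b) = (\<Prod>i\<in>UNIV. v $ i)" for v :: "real ^ 'k::finite"
  proof -
    have "bij_betw (\<lambda>i. axis i (1::real)) UNIV (Basis :: (real ^ 'k) set)"
      by (auto simp: bij_betw_def inj_on_def axis_eq_axis Basis_vec_def)
    from prod.reindex_bij_betw[OF this, of "\<lambda>b. v \<bullet> b"] show ?thesis
      by (simp add: inner_axis)
  qed
  have "emeasure (distr lborel borel ?r) (box l u) = emeasure lborel (?r -` box l u)"
    by (subst emeasure_distr) auto
  also have "\<dots> = (\<Prod>b\<in>Basis. (reindex (inv \<phi>) u - reindex (inv \<phi>) l) \<bullet> b)"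
    unfolding vimage by (rule emeasure_lborel_box[OF le'])
  also have "(\<Prod>b\<in>Basis. (reindex (inv \<phi>) u - reindex (inv \<phi>) l) \<bullet> b) = (\<Prod>b\<in>Basis. (u - l) \<bullet> b)"
    unfolding prodB
    using prod.reindex_bij_betw[OF bij_imp_bij_inv[OF \<phi>], of "\<lambda>i. (u - l) $ i"]
    by (simp add: reindex_def)
  finally show "emeasure (distr lborel borel ?r) (box l u) = (\<Prod>b\<in>Basis. (u - l) \<bullet> b)" .
qed simp

text \<open>Boundedness of the image makes its measure finite, which is what relates the gauge integral of
the Jacobian to its nonnegative Lebesgue integral.\<close>
lemma emeasure_differentiable_image_wellorder:
  fixes f :: "real^'n::{finite,wellorder} \<Rightarrow> real^'n::_"
  assumes "open S" and "open (f ` S)" and "bounded (f ` S)" and "inj_on f S"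
    and "\<And>x. x \<in> S \<Longrightarrow> (f has_derivative f' x) (at x)"
  shows "emeasure lborel (f ` S) = (\<integral>\<^sup>+x\<in>S. \<bar>det (matrix (f' x))\<bar> \<partial>lborel)"
proof -
  have lm: "f ` S \<in> lmeasurable"
    using assms by (intro lmeasurable_open)
  have "((\<lambda>x. \<bar>det (matrix (f' x))\<bar>) has_integral measure lebesgue (f ` S)) S"
    using assms lm by (subst has_measure_differentiable_image[where f = f, symmetric])
      (auto intro: has_derivative_at_withinI)
  hence "(\<integral>\<^sup>+x\<in>S. \<bar>det (matrix (f' x))\<bar> \<partial>lborel) = measure lebesgue (f ` S)"
    by (intro nn_integral_has_integral_lebesgue') auto
  also have "\<dots> = emeasure lebesgue (f ` S)"
    using lm by (simp add: emeasure_eq_measure2 fmeasurableD2)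
  finally show ?thesis
    using assms by simp
qed

text \<open>The formula is applied to the conjugate of \<open>f\<close> by the coordinate permutation \<open>?r\<close>.
Continuity of the Jacobian provides the measurability needed to transport the integral along \<open>?r\<close>.\<close>
lemma emeasure_differentiable_image:
  fixes f :: "real^'n \<Rightarrow> real^'n"
  assumes "open S" and "open (f ` S)" and "bounded (f ` S)" and "inj_on f S"
    and der: "\<And>x. x \<in> S \<Longrightarrow> (f has_derivative f' x) (at x)"
    and cont: "continuous_on S (\<lambda>x. \<bar>det (matrix (f' x))\<bar>)"
  shows "emeasure lborel (f ` S) = (\<integral>\<^sup>+x\<in>S. \<bar>det (matrix (f' x))\<bar> \<partial>lborel)"
proof -
  let ?\<phi> = "Rep_well_ordered :: 'n well_ordered \<Rightarrow> 'n"
  let ?r = "reindex ?\<phi> :: real^'n \<Rightarrow> real^'n well_ordered"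
  let ?r' = "reindex (inv ?\<phi>) :: real^'n well_ordered \<Rightarrow> real^'n"
  \<comment> \<open>The conjugate map, acting on vectors with ordered indices.\<close>
  let ?g = "?r \<circ> f \<circ> ?r'"
  let ?j = "\<lambda>x. ennreal \<bar>det (matrix (f' x))\<bar> * indicator S x"
  note \<phi> = bij_Rep_well_ordered[where 'a = 'n]
  have r [simp]: "?r' (?r v) = v" "?r (?r' w) = w" for v w
    using bij_reindex[OF \<phi>] by auto
  have inj_r: "?r v = ?r w \<longleftrightarrow> v = w" for v w
    by (metis r(1))
  have bl: "bounded_linear ?r" "bounded_linear ?r'"
    using linear_reindex linear_conv_bounded_linear by blast+
  have cont_r: "continuous_on A ?r" "continuous_on B ?r'" for A B
    using bl by (auto intro: linear_continuous_on)
  have [measurable]: "?r \<in> borel_measurable borel" "?r' \<in> borel_measurable borel"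
    using cont_r by (auto intro: borel_measurable_continuous_onI)
  have image: "?r ` A = ?r' -` A" for A
    by (auto simp: image_iff) (metis r(2))
  have open_r: "open (?r ` A)" if "open A" for A
    unfolding image using that cont_r by (intro open_vimage) auto
  have [measurable]: "?j \<in> borel_measurable borel"
  proof -
    have "(\<lambda>x. ennreal (indicator S x *\<^sub>R \<bar>det (matrix (f' x))\<bar>)) \<in> borel_measurable borel"
      using assms(1) cont
      by (intro measurable_compose[OF _ measurable_ennreal] borel_measurable_continuous_on_indicator) auto
    also have "(\<lambda>x. ennreal (indicator S x *\<^sub>R \<bar>det (matrix (f' x))\<bar>)) = ?j"
      by (auto split: split_indicator)
    finally show ?thesis .
  qed
  have gS: "?g ` (?r ` S) = ?r ` f ` S"
    by (simp add: image_comp o_def)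
  have "emeasure lborel (f ` S) = emeasure (distr lborel borel ?r) (?r ` f ` S)"
    using open_r[OF assms(2)] by (subst emeasure_distr) (auto intro!: arg_cong[where f = "emeasure lborel"] simp: image_iff, metis r(1))
  also have "\<dots> = emeasure lborel (?g ` ?r ` S)"
    by (simp only: lborel_reindex[OF \<phi>] gS)
  also have "\<dots> = (\<integral>\<^sup>+y\<in>?r ` S. \<bar>det (matrix (?r \<circ> f' (?r' y) \<circ> ?r'))\<bar> \<partial>lborel)"
  proof (rule emeasure_differentiable_image_wellorder)
    show "open (?r ` S)" "open (?g ` ?r ` S)"
      unfolding gS using assms open_r by auto
    show "bounded (?g ` ?r ` S)"
      unfolding gS by (rule bounded_linear_image[OF assms(3) bl(1)])
    show "inj_on ?g (?r ` S)"
      using \<open>inj_on f S\<close> by (auto simp: inj_on_def inj_r)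
    show "(?g has_derivative (?r \<circ> f' (?r' y) \<circ> ?r')) (at y)" if "y \<in> ?r ` S" for y
    proof (intro diff_chain_at)
      show "(?r' has_derivative ?r') (at y)" "(?r has_derivative ?r) (at (f (?r' y)))"
        using bl by (auto intro: bounded_linear_imp_has_derivative)
      show "(f has_derivative f' (?r' y)) (at (?r' y))"
        using that by (intro der) auto
    qed
  qed
  also have "\<dots> = (\<integral>\<^sup>+y. ?j (?r' y) \<partial>distr lborel borel ?r)"
    unfolding image lborel_reindex[OF \<phi>]
    by (intro nn_integral_cong) (auto simp: det_matrix_reindex[OF \<phi>] split: split_indicator)
  also have "\<dots> = (\<integral>\<^sup>+x\<in>S. \<bar>det (matrix (f' x))\<bar> \<partial>lborel)"
    by (subst nn_integral_distr) auto
  finally show ?thesis .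
qed

section \<open>Balls of an arbitrary norm\<close>

lemma is_normD:
  assumes "is_norm nrm"
  shows "nrm 0 = 0" "nrm x = 0 \<longleftrightarrow> x = 0" "nrm (c *\<^sub>R x) = \<bar>c\<bar> * nrm x" "nrm (x + y) \<le> nrm x + nrm y"
    "nrm (- x) = nrm x" "0 \<le> nrm x" "nrm x - nrm y \<le> nrm (x - y)"
proof -
  show 0: "nrm 0 = 0" and "nrm x = 0 \<longleftrightarrow> x = 0" and s: "nrm (c *\<^sub>R x) = \<bar>c\<bar> * nrm x"
    and tri: "nrm (x + y) \<le> nrm x + nrm y" for c x y
    using assms by (auto simp: is_norm_def)
  show minus: "nrm (- x) = nrm x" for x
    using s[of "- 1" x] by simp
  show "0 \<le> nrm x"
    using tri[of x "- x"] 0 minus[of x] by simp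
  show "nrm x - nrm y \<le> nrm (x - y)"
    using tri[of "x - y" y] by simp
qed

text \<open>Expand a vector in the standard basis and use the triangle inequality.\<close>
lemma is_norm_le_norm:
  fixes nrm :: "'a::euclidean_space \<Rightarrow> real"
  assumes "is_norm nrm"
  obtains C where "C > 0" "\<And>x. nrm x \<le> C * norm x"
proof
  note N = is_normD[OF assms]
  let ?C = "1 + (\<Sum>b\<in>Basis. nrm b)"
  show "?C > 0"
    using N(6) by (intro add_pos_nonneg sum_nonneg) auto
  fix x :: 'a
  have sum_le: "nrm (\<Sum>b\<in>B. g b) \<le> (\<Sum>b\<in>B. nrm (g b))" if "finite B" for g :: "'a \<Rightarrow> 'a" and B
    using that by (induction B rule: finite_induct) (auto simp: N(1) intro: order_trans[OF N(4)])
  have "nrm x = nrm (\<Sum>b\<in>Basis. (x \<bullet> b) *\<^sub>R b)"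
    by (simp add: euclidean_representation)
  also have "\<dots> \<le> (\<Sum>b\<in>Basis. nrm ((x \<bullet> b) *\<^sub>R b))"
    by (rule sum_le) simp
  also have "\<dots> = (\<Sum>b\<in>Basis. \<bar>x \<bullet> b\<bar> * nrm b)"
    by (simp add: N(3))
  also have "\<dots> \<le> (\<Sum>b\<in>Basis. norm x * nrm b)"
    using N(6) by (intro sum_mono mult_right_mono Basis_le_norm) auto
  also have "\<dots> \<le> ?C * norm x"
    by (simp add: sum_distrib_left[symmetric] algebra_simps)
  finally show "nrm x \<le> ?C * norm x" .
qed

lemma continuous_on_is_norm:
  fixes nrm :: "'a::euclidean_space \<Rightarrow> real"
  assumes "is_norm nrm"
  shows "continuous_on A nrm"
proof -
  note N = is_normD[OF assms]
  obtain C where C: "C > 0" "\<And>x. nrm x \<le> C * norm x"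
    using is_norm_le_norm[OF assms] by blast
  have "dist (nrm x) (nrm y) \<le> C * dist x y" for x y
    using N(7)[of x y] N(7)[of y x] C(2)[of "x - y"] C(2)[of "y - x"]
    by (simp add: dist_real_def dist_norm norm_minus_commute)
  hence "C-lipschitz_on A nrm"
    using C(1) by (intro lipschitz_onI) auto
  thus ?thesis
    by (rule lipschitz_on_continuous_on)
qed

text \<open>The constant is the minimum over the Euclidean unit sphere, which is attained by compactness and is
positive because a norm vanishes only at the origin.\<close>
lemma norm_le_is_norm:
  fixes nrm :: "'a::euclidean_space \<Rightarrow> real"
  assumes "is_norm nrm"
  obtains c where "c > 0" "\<And>x. c * norm x \<le> nrm x"
proof -
  note N = is_normD[OF assms]
  have "\<exists>x\<in>sphere 0 1. \<forall>y\<in>sphere 0 1. nrm x \<le> nrm y"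
    by (intro continuous_attains_inf continuous_on_is_norm[OF assms]) auto
  then obtain x0 where x0: "norm x0 = 1" "\<And>y. norm y = 1 \<Longrightarrow> nrm x0 \<le> nrm y"
    by auto
  show thesis
  proof
    have "x0 \<noteq> 0"
      using x0(1) by auto
    thus "nrm x0 > 0"
      using N(2)[of x0] N(6)[of x0] by linarith
    fix x :: 'a
    show "nrm x0 * norm x \<le> nrm x"
    proof (cases "x = 0")
      case False
      have "nrm x0 \<le> nrm (inverse (norm x) *\<^sub>R x)"
        using False by (intro x0(2)) simp
      thus ?thesis
        using False by (simp add: N(3) field_simps)
    qed (simp add: N(1))
  qed
qed

lemma open_nball:
  fixes nrm :: "'a::euclidean_space \<Rightarrow> real"
  assumes "is_norm nrm"
  shows "open (nball nrm z r)"
proof -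
  have "continuous_on UNIV (\<lambda>x. nrm (z - x))"
    by (intro continuous_on_compose2[OF continuous_on_is_norm[OF assms, of UNIV]] continuous_intros) auto
  thus ?thesis
    unfolding nball_def ndist_def by (intro open_Collect_less) auto
qed

lemma bounded_nball:
  fixes nrm :: "'a::euclidean_space \<Rightarrow> real"
  assumes "is_norm nrm"
  shows "bounded (nball nrm z r)"
proof -
  obtain c where c: "c > 0" "\<And>x. c * norm x \<le> nrm x"
    using norm_le_is_norm[OF assms] by blast
  have "dist z x \<le> r / c" if "x \<in> nball nrm z r" for x
    using that c(1) c(2)[of "z - x"] by (auto simp: nball_def ndist_def dist_norm field_simps)
  thus ?thesis
    unfolding bounded_def by blast
qed

lemma nball_subset_open:
  fixes nrm :: "'a::euclidean_space \<Rightarrow> real"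
  assumes "is_norm nrm" and "open G" and "z \<in> G"
  obtains \<rho> where "\<rho> > 0" "\<And>r. r \<le> \<rho> \<Longrightarrow> nball nrm z r \<subseteq> G"
proof -
  obtain c where c: "c > 0" "\<And>x. c * norm x \<le> nrm x"
    using norm_le_is_norm[OF assms(1)] by blast
  obtain d where d: "d > 0" "ball z d \<subseteq> G"
    using assms(2,3) by (meson openE)
  show thesis
  proof
    show "c * d > 0"
      using c d by simp
    fix r assume r: "r \<le> c * d"
    have "dist z x < d" if "x \<in> nball nrm z r" for x
    proof -
      have "c * dist z x < c * d"
        using that r c(2)[of "z - x"] by (auto simp: nball_def ndist_def dist_norm)
      thus ?thesis
        using c(1) by simp
    qed
    thus "nball nrm z r \<subseteq> G"
      using d(2) by auto
  qed
qed

text \<open>The ball is the image of the unit ball under \<open>x \<mapsto> z + r x\<close>, whose Jacobian is \<open>r^DIM('a)\<close>.\<close>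
lemma emeasure_nball:
  fixes nrm :: "'a::euclidean_space \<Rightarrow> real"
  assumes "is_norm nrm" and "r > 0"
  shows "emeasure lborel (nball nrm z r) = ennreal (r ^ DIM('a)) * emeasure lborel (nball nrm 0 1)"
proof -
  note N = is_normD[OF assms(1)]
  note [measurable] = borel_open[OF open_nball[OF assms(1)]]
  have "(\<lambda>x. z + r *\<^sub>R x) -` nball nrm z r = nball nrm 0 1"
    using assms(2) by (auto simp: nball_def ndist_def N(3) N(5))
  moreover have "emeasure lborel (nball nrm z r)
      = emeasure (density (distr lborel borel (\<lambda>x. z + r *\<^sub>R x)) (\<lambda>_. \<bar>r\<bar> ^ DIM('a))) (nball nrm z r)"
    using lborel_affine[of r z] assms(2) by simp
  ultimately show ?thesis
    using assms(2) by (simp add: emeasure_density nn_integral_cmult emeasure_distr)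
qed

lemma emeasure_lborel_open_pos:
  fixes G :: "'a::euclidean_space set"
  assumes "open G" and "G \<noteq> {}"
  shows "emeasure lborel G > 0"
proof -
  obtain x d where d: "d > 0" "ball x d \<subseteq> G"
    using assms by (metis all_not_in_conv openE)
  have "0 < ennreal (measure lborel (ball x d))"
    using d(1) content_ball_pos[of d x] by simp
  also have "\<dots> = emeasure lborel (ball x d)"
    by (intro emeasure_eq_ennreal_measure[symmetric]) (metis bounded_ball emeasure_bounded_finite less_irrefl top.not_eq_extremum infinity_ennreal_def)
  also have "\<dots> \<le> emeasure lborel G"
    using d(2) assms(1) by (intro emeasure_mono) auto
  finally show ?thesis .
qed

lemma emeasure_nleb_borel:
  assumes "A \<in> sets borel"
  shows "emeasure (nleb X) A = inverse (emeasure lebesgue X) * emeasure lborel A"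
  using assms by (simp add: nleb_def)

text \<open>The constant is the normalized volume of the unit ball. It is positive because the unit ball is open and
nonempty, and finite because the unit ball is bounded.\<close>
lemma emeasure_nleb_nball:
  fixes X :: "(real^'n) set"
  assumes "is_norm nrm" and "emeasure lebesgue X \<noteq> 0" and "emeasure lebesgue X \<noteq> \<infinity>"
  obtains \<kappa> where "\<kappa> > 0" "\<And>z r. r > 0 \<Longrightarrow> emeasure (nleb X) (nball nrm z r) = ennreal (\<kappa> * r ^ CARD('n))"
proof -
  let ?B = "nball nrm 0 1 :: (real^'n) set"
  note [measurable] = borel_open[OF open_nball[OF assms(1)]]
  have "?B \<noteq> {}"
    using is_normD(1)[OF assms(1)] by (auto simp: nball_def ndist_def intro!: exI[of _ 0])
  hence pos: "emeasure lborel ?B > 0"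
    by (intro emeasure_lborel_open_pos open_nball assms)
  have fin: "emeasure lborel ?B < \<infinity>"
    by (intro emeasure_bounded_finite bounded_nball assms)
  let ?b = "enn2real (emeasure lborel ?B)" and ?x = "enn2real (emeasure lebesgue X)"
  have b: "emeasure lborel ?B = ennreal ?b" "?b > 0"
    using pos fin by (auto simp: enn2real_positive_iff less_top)
  have x: "emeasure lebesgue X = ennreal ?x" "?x > 0"
    using assms by (auto simp: enn2real_positive_iff less_top zero_less_iff_neq_zero)
  show thesis
  proof (rule that[of "?b / ?x"])
    show "?b / ?x > 0"
      using b x by simp
    show "emeasure (nleb X) (nball nrm z r) = ennreal (?b / ?x * r ^ CARD('n))" if "r > 0" for z r
    proof -
      have "emeasure (nleb X) (nball nrm z r) = inverse (ennreal ?x) * (ennreal (r ^ CARD('n)) * ennreal ?b)"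
        using emeasure_nball[OF assms(1) that, of z] x(1) b(1) by (simp add: emeasure_nleb_borel)
      also have "\<dots> = ennreal (?b / ?x * r ^ CARD('n))"
        using x(2) b(2) that by (simp add: inverse_ennreal ennreal_mult[symmetric] divide_inverse algebra_simps)
      finally show ?thesis .
    qed
  qed
qed

section \<open>The inverse branch, its iterates and their Jacobians\<close>

lemma continuous_on_det_matrix:
  fixes D :: "'a::topological_space \<Rightarrow> (real^'n) \<Rightarrow>\<^sub>L (real^'n)"
  assumes "continuous_on A D"
  shows "continuous_on A (\<lambda>x. det (matrix (blinfun_apply (D x))))"
proof -
  have "continuous_on A (\<lambda>x. matrix (blinfun_apply (D x)) $ i $ j)" for i j
    unfolding matrix_def by (simp, intro continuous_intros assms)
  thus ?thesis
    unfolding det_def by (intro continuous_on_sum continuous_on_mult continuous_on_const continuous_on_prod)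
qed

text \<open>The decisive assumption is \<open>(1 - \<epsilon>) lam < 1\<close>. The map may contract volume, so that one step multiplies a
density by a factor of up to \<open>lam\<close>, but each step also multiplies the weight of the past by \<open>1 - \<epsilon>\<close>.\<close>
locale bounded_contraction =
  fixes X S :: "(real^'n) set" and f :: "real^'n \<Rightarrow> real^'n" and \<epsilon> lam :: real
  assumes compact_X: "compact X" and X_ne: "X \<noteq> {}" and X_regular: "X = closure (interior X)"
    and S_sub: "S \<subseteq> X" and S_null: "emeasure (nleb X) S = 0"
    and f_X: "f ` X \<subseteq> X" and f_meas: "f \<in> measurable (unif X) (unif X)" and f_inj: "inj_on f X"
    and f_diffeo: "C1_diffeo_onto_image f (X - S)"
    and \<epsilon>: "0 < \<epsilon>" "\<epsilon> < 1" and lam: "0 < lam" "lam < inverse (1 - \<epsilon>)"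
    and jac_le: "\<And>x. x \<in> X - S \<Longrightarrow> inverse \<bar>jacobian f x\<bar> \<le> lam"
begin

abbreviation "V \<equiv> X - S"
abbreviation "T \<equiv> inv_into X f"
abbreviation "\<Lambda> \<equiv> Lam X S f"

text \<open>The points that can be iterated \<open>k\<close> times without hitting the singular set. The \<open>k\<close>-th iterate
sends them bijectively onto \<open>\<Lambda> k\<close>; describing \<open>\<Lambda> k\<close> this way replaces statements about iterated inverses
by statements about orbits.\<close>
definition regular :: "nat \<Rightarrow> (real^'n) set" where
  "regular k = {x \<in> X. \<forall>i<k. (f ^^ i) x \<in> V}"

definition pullback :: "nat \<Rightarrow> (real^'n) set \<Rightarrow> (real^'n) set" where
  "pullback k A = {x \<in> regular k. (f ^^ k) x \<in> A}"

lemma open_V: "open V" and open_fV: "open (f ` V)"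
  using f_diffeo by (auto simp: C1_diffeo_onto_image_def)

lemma f_pow_X: "x \<in> X \<Longrightarrow> (f ^^ k) x \<in> X"
  using f_X by (induction k) auto

lemma Lam_eq: "\<Lambda> k = (f ^^ k) ` regular k"
proof (induction k)
  case 0
  show ?case by (auto simp: regular_def)
next
  case (Suc k)
  have regular_Suc: "regular (Suc k) = {x \<in> regular k. (f ^^ k) x \<in> V}"
    by (auto simp: regular_def less_Suc_eq)
  have "(f ^^ k) x \<in> X" if "x \<in> regular k" for x
    using that f_pow_X by (simp add: regular_def)
  hence "(f ^^ k) ` regular (Suc k) = (f ^^ k) ` regular k - S"
    unfolding regular_Suc by auto
  hence "f ` (\<Lambda> k - S) = f ` (f ^^ k) ` regular (Suc k)"
    by (simp only: Suc)
  thus ?case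
    by (simp only: Lam.simps image_comp funpow.simps)
qed

lemma Lam_subset_X: "\<Lambda> k \<subseteq> X"
  using f_pow_X by (auto simp: Lam_eq regular_def)

lemma T_f: "x \<in> X \<Longrightarrow> T (f x) = x"
  using f_inj by simp

lemma T_pow_f_pow: "x \<in> X \<Longrightarrow> i \<le> k \<Longrightarrow> (T ^^ i) ((f ^^ k) x) = (f ^^ (k - i)) x"
proof (induction i arbitrary: k)
  case (Suc i)
  then obtain k' where k: "k = Suc k'"
    by (cases k) auto
  have "(T ^^ Suc i) ((f ^^ k) x) = (T ^^ i) (T (f ((f ^^ k') x)))"
    by (simp add: k funpow_Suc_right del: funpow.simps(2)) (simp add: funpow_swap1)
  also have "\<dots> = (T ^^ i) ((f ^^ k') x)"
    using f_pow_X[OF Suc.prems(1)] by (simp add: T_f)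
  also have "\<dots> = (f ^^ (k' - i)) x"
    using Suc.prems k by (intro Suc.IH) auto
  finally show ?case
    by (simp add: k)
qed simp

lemma T_pow_image: "(T ^^ k) ` (A \<inter> \<Lambda> k) = pullback k A"
proof -
  have "(T ^^ k) ((f ^^ k) x) = x" if "x \<in> regular k" for x
    using that T_pow_f_pow[of x k k] by (simp add: regular_def)
  hence "(T ^^ k) ` (f ^^ k) ` pullback k A = pullback k A"
    unfolding image_image pullback_def by (intro image_cong[where g = id, simplified]) auto
  moreover have "A \<inter> \<Lambda> k = (f ^^ k) ` pullback k A"
    by (auto simp: Lam_eq pullback_def)
  ultimately show ?thesis
    by simp
qed

lemma inj_on_T_pow: "inj_on (T ^^ k) (\<Lambda> k)"
  by (auto simp: inj_on_def Lam_eq T_pow_f_pow regular_def)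

lemma T_Lam: "x \<in> \<Lambda> (Suc k) \<Longrightarrow> T x \<in> \<Lambda> k - S"
  using Lam_subset_X[of k] by (auto simp: T_f)

lemma T_pow_V:
  assumes "x \<in> \<Lambda> k" and "l \<in> {1..k}"
  shows "(T ^^ l) x \<in> V"
  using assms by (auto simp: Lam_eq regular_def T_pow_f_pow)

lemma pullback_Suc: "pullback (Suc k) A = {x \<in> V. f x \<in> pullback k A}"
proof -
  have "x \<in> regular (Suc k) \<longleftrightarrow> x \<in> V \<and> f x \<in> regular k" for x
    using f_X by (auto simp: regular_def funpow_swap1 less_Suc_eq_0_disj all_conj_distrib imp_conjR)
  thus ?thesis
    by (auto simp: pullback_def funpow_swap1)
qed

lemma V_derivative:
  "\<exists>f'. continuous_on V f' \<and> (\<forall>x\<in>V. (f has_derivative blinfun_apply (f' x)) (at x) \<and>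
     jacobian f x = det (matrix (blinfun_apply (f' x))))"
proof -
  obtain f' where f': "\<And>x. x \<in> V \<Longrightarrow> (f has_derivative blinfun_apply (f' x)) (at x)"
    and cont: "continuous_on V f'"
    using f_diffeo by (auto simp: C1_diffeo_onto_image_def C1_on_def)
  have "jacobian f x = det (matrix (blinfun_apply (f' x)))" if "x \<in> V" for x
    using frechet_derivative_at[OF f'[OF that]] by (simp add: jacobian_def)
  with f' cont show ?thesis
    by blast
qed

lemma continuous_on_jacobian: "continuous_on V (jacobian f)"
proof -
  obtain f' where f': "continuous_on V f'"
    "\<forall>x\<in>V. (f has_derivative blinfun_apply (f' x)) (at x) \<and>
     jacobian f x = det (matrix (blinfun_apply (f' x)))"
    using V_derivative by blast
  show ?thesis
    using continuous_on_det_matrix[OF f'(1)] by (rule continuous_on_eq) (use f'(2) in auto)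
qed

text \<open>Differentiate \<open>f \<circ> T = id\<close> on the open set \<open>f ` V\<close>. In this form the lemma also shows that the Jacobian
of \<open>f\<close> does not vanish on \<open>V\<close>.\<close>
lemma T_derivative:
  assumes "y \<in> f ` V"
  obtains D where "(T has_derivative D) (at y)" and "jacobian f (T y) * det (matrix D) = 1"
proof -
  obtain f' where f': "\<forall>x\<in>V. (f has_derivative blinfun_apply (f' x)) (at x) \<and>
     jacobian f x = det (matrix (blinfun_apply (f' x)))"
    using V_derivative by blast
  obtain G where G: "(inv_into V f has_derivative blinfun_apply G) (at y)"
    using f_diffeo assms by (auto simp: C1_diffeo_onto_image_def C1_on_def)
  have inv_eq: "inv_into V f y = T y" if "y \<in> f ` V" for y
    using that f_inj by (auto simp: T_f inj_on_diff)
  have T: "(T has_derivative blinfun_apply G) (at y)"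
    using has_derivative_transform_within_open[OF G open_fV assms] inv_eq by simp
  have TV: "T y \<in> V"
    using assms by (auto simp: T_f)
  have "(f \<circ> T has_derivative blinfun_apply (f' (T y)) \<circ> blinfun_apply G) (at y)"
    using T bspec[OF f' TV] by (intro diff_chain_at) auto
  moreover have "(f \<circ> T has_derivative id) (at y)"
    by (rule has_derivative_transform_within_open[of id _ _ _ "f ` V"])
      (use assms open_fV in \<open>auto simp: T_f id_def\<close>)
  ultimately have "blinfun_apply (f' (T y)) \<circ> blinfun_apply G = id"
    by (rule has_derivative_unique)
  hence "matrix (blinfun_apply (f' (T y))) ** matrix (blinfun_apply G) = mat 1"
    by (metis blinfun.bounded_linear_right bounded_linear.linear matrix_compose matrix_id_mat_1)
  hence "det (matrix (blinfun_apply (f' (T y)))) * det (matrix (blinfun_apply G)) = 1"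
    by (metis det_mul det_I)
  thus thesis
    using that[OF T] bspec[OF f' TV] by simp
qed

lemma jacobian_nonzero:
  assumes "x \<in> V"
  shows "jacobian f x \<noteq> 0"
proof -
  have "f x \<in> f ` V"
    using assms by blast
  then obtain D where "(T has_derivative D) (at (f x))" "jacobian f (T (f x)) * det (matrix D) = 1"
    by (rule T_derivative)
  thus ?thesis
    using assms by (auto simp: T_f)
qed

lemma continuous_on_T: "continuous_on (f ` V) T"
proof (intro continuous_at_imp_continuous_on ballI)
  fix y assume "y \<in> f ` V"
  then obtain D where "(T has_derivative D) (at y)" "jacobian f (T y) * det (matrix D) = 1"
    by (rule T_derivative)
  thus "isCont T y"
    using has_derivative_continuous by blast
qed

text \<open>An open part \<open>W\<close> of \<open>V\<close> has as image the preimage of \<open>W\<close> under \<open>T\<close>, and \<open>T\<close> is continuous on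
the open set \<open>f ` V\<close>. The index starts at 1 since \<open>\<Lambda> 0 = X\<close> is closed.\<close>
lemma open_Lam: "open (\<Lambda> (Suc k))"
proof -
  have open_image: "open (f ` W)" if "open W" "W \<subseteq> V" for W
  proof -
    have "f ` W = f ` V \<inter> T -` W"
      using that(2) T_f by fastforce
    thus ?thesis
      using continuous_open_preimage[OF continuous_on_T open_fV that(1)] by simp
  qed
  show ?thesis
  proof (induction k)
    case 0
    show ?case using open_fV by simp
  next
    case (Suc k)
    have "\<Lambda> (Suc k) - S = \<Lambda> (Suc k) \<inter> V"
      using Lam_subset_X by blast
    hence "open (\<Lambda> (Suc k) - S)"
      using Suc open_V by auto
    thus ?case
      using open_image[of "\<Lambda> (Suc k) - S"] Lam_subset_X[of "Suc k"] by (simp add: Diff_mono)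
  qed
qed

text \<open>This form of the recursion peels off the most recent preimage, in accordance with \<open>T^(k+1) = T^k \<circ> T\<close>.\<close>
lemma J_Suc: "J X f (Suc k) x = inverse \<bar>jacobian f (T x)\<bar> * J X f k (T x)"
proof -
  have "J X f (Suc k) x = (\<Prod>l=Suc 0..Suc k. inverse \<bar>jacobian f ((T ^^ l) x)\<bar>)"
    by (simp add: J_def)
  also have "\<dots> = inverse \<bar>jacobian f (T x)\<bar> * (\<Prod>l=Suc (Suc 0)..Suc k. inverse \<bar>jacobian f ((T ^^ l) x)\<bar>)"
    by (subst prod.atLeast_Suc_atMost) auto
  also have "\<dots> = inverse \<bar>jacobian f (T x)\<bar> * J X f k (T x)"
    unfolding J_def by (subst prod.atLeast_Suc_atMost_Suc_shift) (simp add: o_def funpow_Suc_right del: funpow.simps)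
  finally show ?thesis .
qed

lemma J_bounds:
  assumes "x \<in> \<Lambda> k"
  shows "0 \<le> J X f k x" "J X f k x \<le> lam ^ k"
proof -
  show "0 \<le> J X f k x"
    unfolding J_def by (intro prod_nonneg) auto
  have "J X f k x \<le> (\<Prod>l\<in>{1..k}. lam)"
    unfolding J_def using T_pow_V[OF assms] jac_le by (intro prod_mono) auto
  thus "J X f k x \<le> lam ^ k"
    by simp
qed

lemma continuous_on_J: "continuous_on (\<Lambda> k) (J X f k)"
proof (induction k)
  case 0
  show ?case by (simp add: J_def)
next
  case (Suc k)
  have T: "continuous_on (\<Lambda> (Suc k)) T"
    using Lam_subset_X[of k] by (intro continuous_on_subset[OF continuous_on_T]) auto
  have TV: "T x \<in> V" "T x \<in> \<Lambda> k" if "x \<in> \<Lambda> (Suc k)" for x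
    using T_Lam[OF that] Lam_subset_X by auto
  have jac: "continuous_on (\<Lambda> (Suc k)) (\<lambda>x. jacobian f (T x))"
    using TV by (intro continuous_on_compose2[OF continuous_on_jacobian T]) blast
  have J: "continuous_on (\<Lambda> (Suc k)) (\<lambda>x. J X f k (T x))"
    using TV by (intro continuous_on_compose2[OF Suc T]) blast
  have "continuous_on (\<Lambda> (Suc k)) (\<lambda>x. inverse \<bar>jacobian f (T x)\<bar> * J X f k (T x))"
    using jac J TV jacobian_nonzero by (intro continuous_on_mult continuous_on_inverse continuous_on_rabs) auto
  thus ?case
    by (rule continuous_on_eq) (simp add: J_Suc)
qed

text \<open>Chain rule along \<open>T^(k+1) = T^k \<circ> T\<close>: Jacobians multiply just as in \<open>J_Suc\<close>.\<close>
lemma T_pow_derivative: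
  assumes "x \<in> \<Lambda> k"
  obtains D where "((T ^^ k) has_derivative D) (at x)" "\<bar>det (matrix D)\<bar> = J X f k x"
proof -
  have "\<exists>D. ((T ^^ k) has_derivative D) (at x) \<and> \<bar>det (matrix D)\<bar> = J X f k x"
    using assms
  proof (induction k arbitrary: x)
    case 0
    show ?case
      by (intro exI[of _ id]) (simp add: J_def matrix_id_mat_1 id_def[symmetric])
  next
    case (Suc k)
    have "x \<in> f ` V"
      using Suc.prems Lam_subset_X[of k] by auto
    then obtain D where D: "(T has_derivative D) (at x)" "jacobian f (T x) * det (matrix D) = 1"
      by (rule T_derivative)
    obtain E where E: "((T ^^ k) has_derivative E) (at (T x))" "\<bar>det (matrix E)\<bar> = J X f k (T x)"
      using Suc.IH[of "T x"] T_Lam[OF Suc.prems] by auto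
    have "((T ^^ k) \<circ> T has_derivative E \<circ> D) (at x)"
      using D(1) E(1) by (rule diff_chain_at)
    moreover have "det (matrix (E \<circ> D)) = det (matrix E) * det (matrix D)"
      using D(1) E(1) by (simp add: matrix_compose det_mul has_derivative_linear)
    moreover have "\<bar>det (matrix D)\<bar> = inverse \<bar>jacobian f (T x)\<bar>"
      using D(2) by (metis abs_inverse abs_1 abs_mult inverse_unique)
    ultimately show ?case
      unfolding funpow_Suc_right J_Suc by (intro exI[of _ "E \<circ> D"]) (simp only: abs_mult E(2) mult.commute)
  qed
  thus thesis
    using that by blast
qed

section \<open>Continuity of the density\<close>

abbreviation "h \<equiv> h_eps X S f \<epsilon>"

definition h_term :: "nat \<Rightarrow> real^'n \<Rightarrow> real" where
  "h_term k x = (1 - \<epsilon>) ^ k * (J X f k x * indicator (\<Lambda> k) x)"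

lemma h_term_nonneg: "0 \<le> h_term k x"
  unfolding h_term_def using \<epsilon> J_bounds(1) by (auto split: split_indicator)

lemma h_term_le: "h_term k x \<le> ((1 - \<epsilon>) * lam) ^ k"
  unfolding h_term_def power_mult_distrib using \<epsilon> lam J_bounds(2)
  by (intro mult_left_mono) (auto split: split_indicator)

text \<open>This is where the bound on the volume contraction of \<open>f\<close> enters.\<close>
lemma summable_bound: "summable (\<lambda>k. ((1 - \<epsilon>) * lam) ^ k)"
proof (rule summable_geometric)
  have "(1 - \<epsilon>) * lam < (1 - \<epsilon>) * inverse (1 - \<epsilon>)"
    using \<epsilon> lam by (intro mult_strict_left_mono) auto
  thus "norm ((1 - \<epsilon>) * lam) < 1"
    using \<epsilon> lam by simp
qed

lemma summable_h_term: "summable (\<lambda>k. h_term k x)"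
  using h_term_nonneg h_term_le by (intro summable_comparison_test'[OF summable_bound]) auto

lemma h_eq: "h x = \<epsilon> * (\<Sum>k. h_term k x)"
  by (simp add: h_eps_def h_term_def)

lemma h_nonneg: "0 \<le> h x"
  unfolding h_eq using \<epsilon> h_term_nonneg summable_h_term by (intro mult_nonneg_nonneg suminf_nonneg) auto

lemma h_ge_\<epsilon>:
  assumes "x \<in> X"
  shows "\<epsilon> \<le> h x"
proof -
  have "h_term 0 x = 1"
    using assms by (simp add: h_term_def J_def)
  moreover have "sum (\<lambda>k. h_term k x) {0} \<le> (\<Sum>k. h_term k x)"
    using summable_h_term h_term_nonneg by (intro sum_le_suminf) auto
  ultimately show ?thesis
    unfolding h_eq using \<epsilon>(1) by simp
qed

lemma Lam_inf_subset: "Lam_inf X S f \<subseteq> X" and Lam_inf_subset_Lam: "Lam_inf X S f \<subseteq> \<Lambda> (Suc k)"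
proof -
  show "Lam_inf X S f \<subseteq> \<Lambda> (Suc k)" for k
    unfolding Lam_inf_def by (rule INT_lower) simp
  thus "Lam_inf X S f \<subseteq> X"
    using Lam_subset_X by blast
qed

text \<open>Near a point of \<open>\<Lambda>\<close> the indicator of the open set \<open>\<Lambda> k\<close> is constantly 1. The term \<open>k = 0\<close> is
different, as \<open>\<Lambda> 0 = X\<close> need not be a neighbourhood, but it is constant on \<open>X\<close>.\<close>
lemma continuous_h_term:
  assumes "x \<in> Lam_inf X S f"
  shows "((h_term k) \<longlongrightarrow> h_term k x) (at x within X)"
proof (cases k)
  case 0
  have "eventually (\<lambda>y. h_term 0 y = 1) (at x within X)"
    by (auto simp: eventually_at_filter h_term_def J_def)
  moreover have "x \<in> X"
    using assms Lam_inf_subset by blast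
  ultimately show ?thesis
    unfolding 0 by (intro tendsto_eventually) (simp add: h_term_def J_def)
next
  case (Suc j)
  have x: "x \<in> \<Lambda> k"
    using assms Lam_inf_subset_Lam unfolding Suc by blast
  have "open (\<Lambda> k)"
    unfolding Suc by (rule open_Lam)
  have "isCont (h_term k) x \<longleftrightarrow> isCont (\<lambda>y. (1 - \<epsilon>) ^ k * J X f k y) x"
    using eventually_nhds_in_open[OF \<open>open (\<Lambda> k)\<close> x]
    by (intro isCont_cong, elim eventually_mono) (simp add: h_term_def)
  moreover have "isCont (\<lambda>y. (1 - \<epsilon>) ^ k * J X f k y) x"
    using continuous_on_J[of k] \<open>open (\<Lambda> k)\<close> x
    by (intro isCont_mult continuous_const) (simp add: continuous_on_eq_continuous_at)
  ultimately have "isCont (h_term k) x"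
    by blast
  thus ?thesis
    using continuous_at_imp_continuous_at_within unfolding continuous_within by blast
qed

lemma continuous_h:
  assumes "x \<in> Lam_inf X S f"
  shows "continuous (at x within X) h"
proof -
  have "uniform_limit X (\<lambda>n y. \<Sum>k<n. h_term k y) (\<lambda>y. \<Sum>k. h_term k y) sequentially"
    using h_term_nonneg h_term_le by (intro Weierstrass_m_test[OF _ summable_bound]) auto
  hence "((\<lambda>y. \<Sum>k. h_term k y) \<longlongrightarrow> (\<Sum>k. h_term k x)) (at x within X)"
  proof (rule swap_uniform_limit[rotated 2])
    show "\<forall>\<^sub>F n in sequentially. ((\<lambda>y. \<Sum>k<n. h_term k y) \<longlongrightarrow> (\<Sum>k<n. h_term k x)) (at x within X)"
      using continuous_h_term[OF assms] by (intro always_eventually allI tendsto_sum)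
    show "(\<lambda>n. \<Sum>k<n. h_term k x) \<longlonglongrightarrow> (\<Sum>k. h_term k x)"
      by (rule summable_LIMSEQ[OF summable_h_term])
  qed simp
  thus ?thesis
    unfolding continuous_within h_eq[abs_def] by (rule tendsto_mult_left)
qed

section \<open>The stationary measure as a series over the past\<close>

lemma emeasure_X: "emeasure lebesgue X \<noteq> 0" "emeasure lebesgue X \<noteq> \<infinity>"
proof -
  have "interior X \<noteq> {}"
    using X_ne X_regular by auto
  hence "0 < emeasure lborel (interior X)"
    by (intro emeasure_lborel_open_pos) auto
  also have "\<dots> = emeasure lebesgue (interior X)"
    by simp
  also have "\<dots> \<le> emeasure lebesgue X"
    using compact_X by (intro emeasure_mono interior_subset) (auto intro: lmeasurable_compact fmeasurableD)
  finally show "emeasure lebesgue X \<noteq> 0"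
    by simp
  show "emeasure lebesgue X \<noteq> \<infinity>"
    using fmeasurableD2[OF lmeasurable_compact[OF compact_X]] by simp
qed

lemma X_lebesgue: "X \<in> sets lebesgue"
  using compact_X by (auto intro: lmeasurable_compact fmeasurableD)

lemma space_unif: "space (unif X) = X"
  by (simp add: unif_def nleb_def space_restrict_space space_scale_measure)

lemma sets_unif: "A \<in> sets (unif X) \<longleftrightarrow> A \<subseteq> X \<and> A \<in> sets lebesgue"
  using X_lebesgue unfolding unif_def by (subst sets_restrict_space_iff) (auto simp: nleb_def)

lemma emeasure_unif: "A \<subseteq> X \<Longrightarrow> emeasure (unif X) A = emeasure (nleb X) A"
  using X_lebesgue unfolding unif_def by (intro emeasure_restrict_space) (auto simp: nleb_def)

lemma prob_space_unif: "prob_space (unif X)"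
proof
  have "inverse (emeasure lebesgue X) * emeasure lebesgue X = 1"
    using emeasure_X
    by (cases "emeasure lebesgue X") (auto simp: inverse_ennreal ennreal_mult[symmetric] simp flip: ennreal_1)
  thus "emeasure (unif X) (space (unif X)) = 1"
    by (simp add: space_unif emeasure_unif nleb_def)
qed

lemma prob_space_theta: "prob_space (theta X \<epsilon>)"
  unfolding theta_def using prob_space_unif measure_pmf.prob_space_axioms
  by (intro prob_space_pair)

text \<open>The two outcomes of the coin are integrated separately. The first leaves an integrand that does not
depend on the uniform point, the second one that depends on nothing else.\<close>
lemma nn_integral_theta:
  assumes A: "A \<in> sets (unif X)" and x: "x \<in> X"
  shows "(\<integral>\<^sup>+\<omega>. indicator A (rmap f \<omega> x) \<partial>theta X \<epsilon>)
    = ennreal (1 - \<epsilon>) * indicator A (f x) + ennreal \<epsilon> * emeasure (unif X) A"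
proof -
  interpret unif: prob_space "unif X"
    by (rule prob_space_unif)
  note [measurable] = A
  have rmap: "rmap f \<omega> x = (if fst \<omega> then f x else snd \<omega>)" for \<omega>
    by (cases \<omega>) (simp add: rmap_def)
  have [measurable]: "(\<lambda>\<omega>. indicator A (rmap f \<omega> x) :: ennreal)
      \<in> borel_measurable (measure_pmf (bernoulli_pmf (1 - \<epsilon>)) \<Otimes>\<^sub>M unif X)"
  proof -
    have "(\<lambda>\<omega>. if fst \<omega> then indicator A (f x) else indicator A (snd \<omega>) :: ennreal)
      \<in> borel_measurable (measure_pmf (bernoulli_pmf (1 - \<epsilon>)) \<Otimes>\<^sub>M unif X)"
      by measurable
    thus ?thesis
      by (simp add: rmap if_distrib)
  qed
  have "(\<integral>\<^sup>+\<omega>. indicator A (rmap f \<omega> x) \<partial>theta X \<epsilon>)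
    = (\<integral>\<^sup>+\<eta>. (\<integral>\<^sup>+\<xi>. indicator A (rmap f (\<eta>, \<xi>) x) \<partial>unif X) \<partial>measure_pmf (bernoulli_pmf (1 - \<epsilon>)))"
    unfolding theta_def by (rule unif.nn_integral_fst[symmetric]) measurable
  also have "\<dots> = ennreal (1 - \<epsilon>) * indicator A (f x) + ennreal \<epsilon> * emeasure (unif X) A"
    using \<epsilon> A by (simp add: rmap unif.emeasure_space_1 mult.commute)
  finally show ?thesis .
qed

lemma open_subset_unif: "open A \<Longrightarrow> A \<subseteq> X \<Longrightarrow> A \<in> sets (unif X)"
  by (simp add: sets_unif)

lemma open_Int_Lam:
  assumes "open A" "A \<subseteq> X"
  shows "open (A \<inter> \<Lambda> k)"
proof (cases k)
  case 0
  thus ?thesis using assms by (simp add: Int_absorb2)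
next
  case (Suc j)
  thus ?thesis using assms open_Lam by blast
qed

text \<open>The pullback is the injective continuous image of an open set under \<open>T^k\<close>, so invariance of domain applies.\<close>
lemma open_pullback:
  assumes "open A" "A \<subseteq> X"
  shows "open (pullback k A)"
proof -
  have "continuous_on (A \<inter> \<Lambda> k) (T ^^ k)"
  proof (intro continuous_at_imp_continuous_on ballI)
    fix x assume "x \<in> A \<inter> \<Lambda> k"
    then obtain D where "((T ^^ k) has_derivative D) (at x)" "\<bar>det (matrix D)\<bar> = J X f k x"
      using T_pow_derivative[of x k] by (metis IntD2)
    thus "isCont (T ^^ k) x"
      using has_derivative_continuous by blast
  qed
  moreover have "inj_on (T ^^ k) (A \<inter> \<Lambda> k)"
    using inj_on_T_pow by (rule inj_on_subset) simp
  ultimately show ?thesis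
    using invariance_of_domain open_Int_Lam[OF assms] by (metis T_pow_image)
qed

lemma pullback_subset_X: "pullback k A \<subseteq> X"
  by (auto simp: pullback_def regular_def)

lemma emeasure_pullback:
  assumes "open A" "A \<subseteq> X"
  shows "emeasure lborel (pullback k A) = (\<integral>\<^sup>+x\<in>A \<inter> \<Lambda> k. J X f k x \<partial>lborel)"
proof -
  have "\<forall>x\<in>\<Lambda> k. \<exists>D. ((T ^^ k) has_derivative D) (at x) \<and> \<bar>det (matrix D)\<bar> = J X f k x"
    using T_pow_derivative by metis
  then obtain D where D: "\<And>x. x \<in> \<Lambda> k \<Longrightarrow> ((T ^^ k) has_derivative D x) (at x)"
    "\<And>x. x \<in> \<Lambda> k \<Longrightarrow> \<bar>det (matrix (D x))\<bar> = J X f k x"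
    by metis
  have "emeasure lborel ((T ^^ k) ` (A \<inter> \<Lambda> k)) = (\<integral>\<^sup>+x\<in>A \<inter> \<Lambda> k. \<bar>det (matrix (D x))\<bar> \<partial>lborel)"
  proof (rule emeasure_differentiable_image)
    show "open ((T ^^ k) ` (A \<inter> \<Lambda> k))"
      using open_pullback[OF assms] by (simp add: T_pow_image)
    show "bounded ((T ^^ k) ` (A \<inter> \<Lambda> k))"
      unfolding T_pow_image using compact_X pullback_subset_X by (metis bounded_subset compact_imp_bounded)
    show "inj_on (T ^^ k) (A \<inter> \<Lambda> k)"
      using inj_on_T_pow by (rule inj_on_subset) simp
    have "continuous_on (A \<inter> \<Lambda> k) (J X f k)"
      using continuous_on_J by (rule continuous_on_subset) simp
    thus "continuous_on (A \<inter> \<Lambda> k) (\<lambda>x. \<bar>det (matrix (D x))\<bar>)"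
      by (rule continuous_on_eq) (simp add: D(2))
  qed (use D(1) open_Int_Lam[OF assms] in auto)
  also have "\<dots> = (\<integral>\<^sup>+x\<in>A \<inter> \<Lambda> k. J X f k x \<partial>lborel)"
    using D(2) by (intro nn_integral_cong) (auto split: split_indicator)
  finally show ?thesis
    by (simp add: T_pow_image)
qed

lemma h_term_borel [measurable]: "h_term k \<in> borel_measurable borel"
proof -
  have "\<Lambda> k \<in> sets borel"
    using compact_X open_Lam by (cases k) (auto intro: borel_compact simp del: Lam.simps(2))
  hence "(\<lambda>x. indicator (\<Lambda> k) x *\<^sub>R J X f k x) \<in> borel_measurable borel"
    using continuous_on_J by (intro borel_measurable_continuous_on_indicator) auto
  thus ?thesis
    unfolding h_term_def[abs_def] by (simp add: mult.commute)
qed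

lemma nn_integral_nleb:
  assumes "g \<in> borel_measurable borel"
  shows "nn_integral (nleb X) g = inverse (emeasure lebesgue X) * nn_integral lborel g"
  unfolding nleb_def using assms
  by (subst nn_integral_scale_measure) (auto intro: measurable_completion simp: nn_integral_completion)

end

text \<open>That \<open>\<mu>\<close> has density \<open>h\<close> is derived from stationarity and absolute continuity, not assumed.\<close>
locale stationary_perturbation = bounded_contraction X S f \<epsilon> lam
  for X S :: "(real^'n) set" and f :: "real^'n \<Rightarrow> real^'n" and \<epsilon> lam :: real +
  fixes \<mu> :: "(real^'n) measure"
  assumes acs: "acs_prob_measure X f \<epsilon> \<mu>"
begin

sublocale \<mu>: prob_space \<mu>
  using acs by (simp add: acs_prob_measure_def)

lemma sets_\<mu>: "sets \<mu> = sets (unif X)" and space_\<mu>: "space \<mu> = X"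
  using acs sets_eq_imp_space_eq[of \<mu> "unif X"] by (simp_all add: acs_prob_measure_def space_unif)

lemma stationary:
  assumes A: "A \<in> sets (unif X)"
  shows "measure \<mu> A = \<epsilon> * measure (unif X) A + (1 - \<epsilon>) * measure \<mu> (f -` A \<inter> X)"
proof -
  interpret unif: prob_space "unif X"
    by (rule prob_space_unif)
  have vimage: "f -` A \<inter> X \<in> sets \<mu>"
    using measurable_sets[OF f_meas A] by (simp add: sets_\<mu> space_unif)
  have ind: "indicator A (f x) = (indicator (f -` A \<inter> X) x :: ennreal)" if "x \<in> X" for x
    using that by (simp add: indicator_def)
  have "emeasure \<mu> A = (\<integral>\<^sup>+x. (\<integral>\<^sup>+\<omega>. indicator A (rmap f \<omega> x) \<partial>theta X \<epsilon>) \<partial>\<mu>)"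
    using acs A by (simp add: acs_prob_measure_def)
  also have "\<dots> = (\<integral>\<^sup>+x. ennreal (1 - \<epsilon>) * indicator (f -` A \<inter> X) x + ennreal \<epsilon> * emeasure (unif X) A \<partial>\<mu>)"
    using nn_integral_theta[OF A] ind by (intro nn_integral_cong) (simp add: space_\<mu>)
  also have "\<dots> = ennreal (1 - \<epsilon>) * emeasure \<mu> (f -` A \<inter> X) + ennreal \<epsilon> * emeasure (unif X) A"
    using vimage by (simp add: nn_integral_add nn_integral_cmult \<mu>.emeasure_space_1)
  also have "\<dots> = ennreal ((1 - \<epsilon>) * measure \<mu> (f -` A \<inter> X) + \<epsilon> * measure (unif X) A)"
    using \<epsilon> by (simp add: \<mu>.emeasure_eq_measure unif.emeasure_eq_measure ennreal_mult[symmetric] ennreal_plus[symmetric] del: ennreal_plus)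
  finally have "ennreal (measure \<mu> A) = ennreal ((1 - \<epsilon>) * measure \<mu> (f -` A \<inter> X) + \<epsilon> * measure (unif X) A)"
    by (simp only: \<mu>.emeasure_eq_measure)
  hence "measure \<mu> A = (1 - \<epsilon>) * measure \<mu> (f -` A \<inter> X) + \<epsilon> * measure (unif X) A"
    using \<epsilon> by (subst (asm) ennreal_inj) (auto intro!: add_nonneg_nonneg mult_nonneg_nonneg)
  thus ?thesis
    by (simp only: add.commute)
qed

lemma S_null_\<mu>: "S \<in> null_sets \<mu>"
proof -
  have "S = X - V"
    using S_sub by auto
  hence "S \<in> sets lebesgue"
    using X_lebesgue open_V by (metis borel_open lmeasurable_compact sets.Diff sets_completionI_sets sets_lborel)
  hence "S \<in> null_sets (unif X)"
    using S_null S_sub by (auto intro!: null_setsI simp: sets_unif emeasure_unif)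
  thus ?thesis
    using acs by (auto simp: acs_prob_measure_def absolutely_continuous_def)
qed

text \<open>Stationarity refers to the full preimage under \<open>f\<close>, whereas a pullback is required to avoid \<open>S\<close>.
The two differ inside \<open>S\<close>, which is null for \<open>\<mu>\<close> by absolute continuity.\<close>
lemma stationary_iterate:
  assumes A: "open A" "A \<subseteq> X"
  shows "measure \<mu> A = (\<Sum>k<n. \<epsilon> * (1 - \<epsilon>) ^ k * measure (unif X) (pullback k A))
    + (1 - \<epsilon>) ^ n * measure \<mu> (pullback n A)"
proof (induction n)
  case 0
  have "pullback 0 A = A"
    using A by (auto simp: pullback_def regular_def)
  thus ?case by simp
next
  case (Suc n)
  let ?P = "pullback n A"
  have sets: "pullback k A \<in> sets (unif X)" for k
    using open_pullback[OF A] pullback_subset_X by (rule open_subset_unif)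
  have "measure \<mu> (f -` ?P \<inter> X) = measure \<mu> (pullback (Suc n) A)"
  proof (rule measure_eq_AE)
    show "AE x in \<mu>. x \<in> f -` ?P \<inter> X \<longleftrightarrow> x \<in> pullback (Suc n) A"
      using AE_not_in[OF S_null_\<mu>] AE_space[of \<mu>] by eventually_elim (auto simp: pullback_Suc space_\<mu>)
    show "f -` ?P \<inter> X \<in> sets \<mu>"
      using measurable_sets[OF f_meas sets[of n]] by (simp add: sets_\<mu> space_unif)
    show "pullback (Suc n) A \<in> sets \<mu>"
      using sets by (simp add: sets_\<mu>)
  qed
  hence "measure \<mu> ?P = \<epsilon> * measure (unif X) ?P + (1 - \<epsilon>) * measure \<mu> (pullback (Suc n) A)"
    using stationary[OF sets[of n]] by simp
  hence "(1 - \<epsilon>) ^ n * measure \<mu> ?P = \<epsilon> * (1 - \<epsilon>) ^ n * measure (unif X) ?P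
      + (1 - \<epsilon>) ^ Suc n * measure \<mu> (pullback (Suc n) A)"
    by (simp add: distrib_left mult_ac)
  thus ?case
    using Suc by simp
qed

text \<open>The remainder is the contribution of the orbits without a uniform jump in the last \<open>n\<close> steps, which is at most \<open>(1 - \<epsilon>)^n\<close>.\<close>
lemma stationary_sums:
  assumes A: "open A" "A \<subseteq> X"
  shows "(\<lambda>k. \<epsilon> * (1 - \<epsilon>) ^ k * measure (unif X) (pullback k A)) sums measure \<mu> A"
proof -
  have "(\<lambda>n. (1 - \<epsilon>) ^ n * measure \<mu> (pullback n A)) \<longlonglongrightarrow> 0"
  proof (rule tendsto_sandwich[OF _ _ tendsto_const])
    show "(\<lambda>n. (1 - \<epsilon>) ^ n) \<longlonglongrightarrow> 0"
      using \<epsilon> by (intro LIMSEQ_power_zero) auto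
    show "\<forall>\<^sub>F n in sequentially. (1 - \<epsilon>) ^ n * measure \<mu> (pullback n A) \<le> (1 - \<epsilon>) ^ n"
      using \<epsilon> by (intro always_eventually allI mult_left_le) auto
  qed (use \<epsilon> in auto)
  hence "(\<lambda>n. measure \<mu> A - (1 - \<epsilon>) ^ n * measure \<mu> (pullback n A)) \<longlonglongrightarrow> measure \<mu> A - 0"
    by (intro tendsto_intros)
  moreover have "measure \<mu> A - (1 - \<epsilon>) ^ n * measure \<mu> (pullback n A)
      = (\<Sum>k<n. \<epsilon> * (1 - \<epsilon>) ^ k * measure (unif X) (pullback k A))" for n
    using stationary_iterate[OF A, of n] by simp
  ultimately show ?thesis
    by (simp add: sums_def)
qed

text \<open>The \<open>k\<close>-th term of the series for \<open>\<mu> A\<close> is, by the change of variables \<open>T^k\<close>, the integral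
over \<open>A\<close> of the \<open>k\<close>-th term of \<open>h\<close>; sum and integral commute because all terms are nonnegative.\<close>
lemma emeasure_\<mu>_eq_integral_h:
  assumes A: "open A" "A \<subseteq> X"
  shows "emeasure \<mu> A = (\<integral>\<^sup>+x\<in>A. h x \<partial>nleb X)"
proof -
  interpret unif: prob_space "unif X"
    by (rule prob_space_unif)
  note [measurable] = borel_open[OF A(1)]
  let ?c = "inverse (emeasure lebesgue X)"
  have h_sum: "(\<Sum>k. ennreal (\<epsilon> * h_term k x)) = ennreal (h x)" for x
    using \<epsilon> h_term_nonneg summable_h_term unfolding h_eq
    by (subst suminf_ennreal2) (auto intro: summable_mult simp: suminf_mult)
  have pull: "ennreal (\<epsilon> * (1 - \<epsilon>) ^ k * measure (unif X) (pullback k A))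
      = (\<integral>\<^sup>+x\<in>A. \<epsilon> * h_term k x \<partial>nleb X)" for k
  proof -
    have J_ind: "h_term k x = (1 - \<epsilon>) ^ k * J X f k x" "0 \<le> J X f k x" if "x \<in> \<Lambda> k" for x
      using that J_bounds(1) by (auto simp: h_term_def)
    have "ennreal (measure (unif X) (pullback k A)) = ?c * emeasure lborel (pullback k A)"
      using pullback_subset_X open_pullback[OF A]
      by (simp add: unif.emeasure_eq_measure[symmetric] emeasure_unif emeasure_nleb_borel)
    also have "\<dots> = ?c * (\<integral>\<^sup>+x\<in>A \<inter> \<Lambda> k. J X f k x \<partial>lborel)"
      by (simp add: emeasure_pullback[OF A])
    finally have "ennreal (\<epsilon> * (1 - \<epsilon>) ^ k * measure (unif X) (pullback k A))
        = ?c * (ennreal (\<epsilon> * (1 - \<epsilon>) ^ k) * (\<integral>\<^sup>+x\<in>A \<inter> \<Lambda> k. J X f k x \<partial>lborel))"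
      using \<epsilon> by (simp add: ennreal_mult mult.left_commute)
    also have "ennreal (\<epsilon> * (1 - \<epsilon>) ^ k) * (\<integral>\<^sup>+x\<in>A \<inter> \<Lambda> k. J X f k x \<partial>lborel)
        = (\<integral>\<^sup>+x. ennreal (\<epsilon> * (1 - \<epsilon>) ^ k) * (ennreal (J X f k x) * indicator (A \<inter> \<Lambda> k) x) \<partial>lborel)"
    proof (rule nn_integral_cmult[symmetric])
      have "(\<lambda>x. ennreal (indicator (A \<inter> \<Lambda> k) x *\<^sub>R J X f k x)) \<in> borel_measurable borel"
        using continuous_on_subset[OF continuous_on_J] borel_open[OF open_Int_Lam[OF A]]
        by (intro measurable_compose[OF _ measurable_ennreal] borel_measurable_continuous_on_indicator) auto
      also have "(\<lambda>x. ennreal (indicator (A \<inter> \<Lambda> k) x *\<^sub>R J X f k x)) = (\<lambda>x. ennreal (J X f k x) * indicator (A \<inter> \<Lambda> k) x)"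
        by (auto split: split_indicator)
      finally show "(\<lambda>x. ennreal (J X f k x) * indicator (A \<inter> \<Lambda> k) x) \<in> borel_measurable lborel"
        by simp
    qed
    also have "\<dots> = (\<integral>\<^sup>+x\<in>A. \<epsilon> * h_term k x \<partial>lborel)"
    proof (rule nn_integral_cong)
      fix x
      show "ennreal (\<epsilon> * (1 - \<epsilon>) ^ k) * (ennreal (J X f k x) * indicator (A \<inter> \<Lambda> k) x)
          = ennreal (\<epsilon> * h_term k x) * indicator A x"
        using \<epsilon> J_ind[of x] by (cases "x \<in> \<Lambda> k") (auto simp: ennreal_mult[symmetric] h_term_def mult.assoc split: split_indicator)
    qed
    also have "?c * \<dots> = (\<integral>\<^sup>+x\<in>A. \<epsilon> * h_term k x \<partial>nleb X)"
      by (rule nn_integral_nleb[symmetric]) measurable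
    finally show ?thesis .
  qed
  have "emeasure \<mu> A = ennreal (\<Sum>k. \<epsilon> * (1 - \<epsilon>) ^ k * measure (unif X) (pullback k A))"
    using stationary_sums[OF A] by (simp add: \<mu>.emeasure_eq_measure sums_iff)
  also have "\<dots> = (\<Sum>k. (\<integral>\<^sup>+x\<in>A. \<epsilon> * h_term k x \<partial>nleb X))"
    using \<epsilon> stationary_sums[OF A] by (subst suminf_ennreal2[symmetric]) (auto simp: sums_iff pull)
  also have "\<dots> = (\<integral>\<^sup>+x. (\<Sum>k. ennreal (\<epsilon> * h_term k x) * indicator A x) \<partial>nleb X)"
  proof (rule nn_integral_suminf[symmetric])
    have "(\<lambda>x. ennreal (\<epsilon> * h_term k x) * indicator A x) \<in> borel_measurable borel" for k
      by measurable
    thus "(\<lambda>x. ennreal (\<epsilon> * h_term k x) * indicator A x) \<in> borel_measurable (nleb X)" for k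
      by (simp add: nleb_def measurable_completion cong: measurable_cong_sets)
  qed
  also have "\<dots> = (\<integral>\<^sup>+x\<in>A. h x \<partial>nleb X)"
    by (simp add: h_sum)
  finally show ?thesis .
qed

section \<open>Asymptotics of small balls\<close>

text \<open>On a small ball \<open>h\<close> stays within \<open>\<delta>\<close> of \<open>h z\<close>, so the mean of \<open>h\<close> over the ball does. The ball must lie
in \<open>X\<close> for \<open>\<mu>\<close> to be compared with the Lebesgue measure of the whole ball; it does for small radii because \<open>z\<close> lies in the
open set \<open>\<Lambda> 1 \<subseteq> X\<close>.\<close>
lemma \<mu>_density_at_Lam_inf:
  assumes nrm: "is_norm nrm" and z: "z \<in> Lam_inf X S f"
  shows "((\<lambda>r. measure \<mu> (nball nrm z r) / measure (nleb X) (nball nrm z r)) \<longlongrightarrow> h z) (at_right 0)"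
proof (rule tendstoI)
  fix e :: real assume "e > 0"
  \<comment> \<open>The integral inequalities are not strict, so a tolerance below \<open>e\<close> is used for \<open>h\<close>.\<close>
  define \<delta> where "\<delta> = e / 2"
  have \<delta>: "\<delta> > 0" "\<delta> < e"
    using \<open>e > 0\<close> by (auto simp: \<delta>_def)
  obtain \<kappa> where \<kappa>: "\<kappa> > 0"
    "\<And>z r. r > 0 \<Longrightarrow> emeasure (nleb X) (nball nrm z r) = ennreal (\<kappa> * r ^ CARD('n))"
    using emeasure_nleb_nball[OF nrm emeasure_X] by blast
  have "\<forall>\<^sub>F y in at z within X. dist (h y) (h z) < \<delta>"
    using continuous_h[OF z] \<delta>(1) unfolding continuous_within by (rule tendstoD)
  then obtain W where W: "open W" "z \<in> W" "\<And>y. y \<in> W \<Longrightarrow> y \<noteq> z \<Longrightarrow> y \<in> X \<Longrightarrow> dist (h y) (h z) < \<delta>"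
    unfolding eventually_at_topological by blast
  have G: "open (W \<inter> \<Lambda> (Suc 0))" "z \<in> W \<inter> \<Lambda> (Suc 0)"
    using W open_Lam[of 0] z Lam_inf_subset_Lam[of 0] by blast+
  obtain \<rho> where \<rho>: "\<rho> > 0" "\<And>r. r \<le> \<rho> \<Longrightarrow> nball nrm z r \<subseteq> W \<inter> \<Lambda> (Suc 0)"
    using nball_subset_open[OF nrm G] by blast
  have "dist (measure \<mu> (nball nrm z r) / measure (nleb X) (nball nrm z r)) (h z) < e" if r: "0 < r" "r < \<rho>" for r
  proof -
    let ?B = "nball nrm z r"
    let ?m = "measure (nleb X) ?B"
    have B: "open ?B" "?B \<subseteq> X"
      using open_nball[OF nrm] \<rho>(2)[of r] r Lam_subset_X[of "Suc 0"] by auto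
    have m: "emeasure (nleb X) ?B = ennreal ?m" "?m > 0"
      using \<kappa> r by (simp_all add: measure_def)
    have close: "\<bar>h x - h z\<bar> \<le> \<delta>" if "x \<in> ?B" for x
    proof (cases "x = z")
      case False
      have "x \<in> W" "x \<in> X"
        using that B(2) \<rho>(2)[of r] r by auto
      thus ?thesis
        using W(3)[of x] False by (simp add: dist_real_def)
    qed (use \<delta>(1) in simp)
    have sets: "?B \<in> sets (nleb X)"
      using B(1) by (simp add: nleb_def)
    have \<mu>_eq: "ennreal (measure \<mu> ?B) = (\<integral>\<^sup>+x\<in>?B. h x \<partial>nleb X)"
      using emeasure_\<mu>_eq_integral_h[OF B] by (simp add: \<mu>.emeasure_eq_measure)
    have const: "(\<integral>\<^sup>+x\<in>?B. ennreal c \<partial>nleb X) = ennreal c * ennreal ?m" for c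
      using sets by (simp add: nn_integral_cmult_indicator m(1))
    have "ennreal (measure \<mu> ?B) \<le> (\<integral>\<^sup>+x\<in>?B. (h z + \<delta>) \<partial>nleb X)"
      unfolding \<mu>_eq
    proof (rule nn_integral_mono)
      fix x show "ennreal (h x) * indicator ?B x \<le> ennreal (h z + \<delta>) * indicator ?B x"
        using close[of x] by (auto split: split_indicator intro!: ennreal_leI)
    qed
    also have "\<dots> = ennreal ((h z + \<delta>) * ?m)"
      unfolding const using h_nonneg[of z] \<delta> m(2) by (simp add: ennreal_mult)
    finally have upper: "measure \<mu> ?B \<le> (h z + \<delta>) * ?m"
      using h_nonneg[of z] \<delta> m(2) by (subst (asm) ennreal_le_iff) auto
    have lower: "(h z - \<delta>) * ?m \<le> measure \<mu> ?B"
    proof (cases "h z - \<delta> \<ge> 0")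
      case True
      have "ennreal ((h z - \<delta>) * ?m) = (\<integral>\<^sup>+x\<in>?B. (h z - \<delta>) \<partial>nleb X)"
        unfolding const using True by (simp add: ennreal_mult)
      also have "\<dots> \<le> ennreal (measure \<mu> ?B)"
        unfolding \<mu>_eq
      proof (rule nn_integral_mono)
        fix x show "ennreal (h z - \<delta>) * indicator ?B x \<le> ennreal (h x) * indicator ?B x"
          using close[of x] by (auto split: split_indicator intro!: ennreal_leI)
      qed
      finally show ?thesis
        by (subst (asm) ennreal_le_iff) auto
    next
      case False
      hence "(h z - \<delta>) * ?m \<le> 0"
        using m(2) by (intro mult_nonpos_nonneg) auto
      also have "0 \<le> measure \<mu> ?B"
        by simp
      finally show ?thesis .
    qed
    have "\<bar>measure \<mu> ?B / ?m - h z\<bar> \<le> \<delta>"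
      using upper lower m(2) by (simp add: abs_le_iff field_simps)
    thus ?thesis
      using \<delta>(2) by (simp add: dist_real_def)
  qed
  thus "\<forall>\<^sub>F r in at_right 0. dist (measure \<mu> (nball nrm z r) / measure (nleb X) (nball nrm z r)) (h z) < e"
    using \<rho>(1) unfolding eventually_at_right_field by blast
qed

text \<open>The levels \<open>u n\<close> multiply the radius by \<open>\<tau>^(1/D)\<close>, hence the measure of the ball by \<open>\<tau>\<close>.\<close>
lemma n_\<mu>_nball_tendsto:
  assumes nrm: "is_norm nrm" and z: "z \<in> Lam_inf X S f" and \<tau>: "\<tau> > 0"
    and b: "\<And>n. n \<ge> 1 \<Longrightarrow> measure (nleb X) (nball nrm z (exp (- b n))) = 1 / (real n * h z)"
    and u: "\<And>n. n \<ge> 1 \<Longrightarrow> u n = - ln \<tau> / CARD('n) + b n"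
  shows "(\<lambda>n. real n * measure \<mu> (nball nrm z (exp (- u n)) \<inter> X)) \<longlonglongrightarrow> \<tau>"
proof -
  let ?D = "CARD('n)"
  let ?s = "\<lambda>n. exp (- u n)"
  have hz: "h z > 0"
    using h_ge_\<epsilon>[of z] \<epsilon>(1) z Lam_inf_subset by fastforce
  obtain \<kappa> where \<kappa>: "\<kappa> > 0"
    and \<kappa>_ball: "\<And>z r. r > 0 \<Longrightarrow> emeasure (nleb X) (nball nrm z r) = ennreal (\<kappa> * r ^ ?D)"
    using emeasure_nleb_nball[OF nrm emeasure_X] by blast
  have measure_ball: "measure (nleb X) (nball nrm z r) = \<kappa> * r ^ ?D" if "r > 0" for r
    using \<kappa>_ball[OF that] \<kappa> that by (simp add: measure_def)
  \<comment> \<open>Since \<open>exp (ln \<tau> / D)^D = \<tau>\<close>, the ball at level \<open>u n\<close> has \<open>\<tau>\<close> times the measure of the one at level \<open>b n\<close>.\<close>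
  have s_pow: "\<kappa> * ?s n ^ ?D = \<tau> / h z / real n" if "n \<ge> 1" for n
  proof -
    have "?s n ^ ?D = exp (ln \<tau>) * exp (- b n) ^ ?D"
      by (simp add: u[OF that] exp_of_nat_mult[symmetric] exp_add[symmetric] algebra_simps del: exp_ln)
    hence "\<kappa> * ?s n ^ ?D = \<tau> * (\<kappa> * exp (- b n) ^ ?D)"
      using \<tau> by simp
    also have "\<kappa> * exp (- b n) ^ ?D = 1 / (real n * h z)"
      using b[OF that] measure_ball[of "exp (- b n)"] by simp
    finally show ?thesis
      by simp
  qed
  have "(\<lambda>n. root ?D (\<tau> / h z / \<kappa> / real n)) \<longlonglongrightarrow> root ?D 0"
    by (intro tendsto_real_root lim_const_over_n)
  moreover have "\<forall>\<^sub>F n in sequentially. root ?D (\<tau> / h z / \<kappa> / real n) = ?s n"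
    using eventually_ge_at_top[of 1]
  proof eventually_elim
    case (elim n)
    have "?s n ^ ?D = \<kappa> * ?s n ^ ?D / \<kappa>"
      using \<kappa> by simp
    also have "\<dots> = \<tau> / h z / \<kappa> / real n"
      unfolding s_pow[OF elim] by (simp add: mult.commute)
    finally have "?s n ^ ?D = \<tau> / h z / \<kappa> / real n" .
    thus ?case
      using real_root_power_cancel[of ?D "?s n"] by simp
  qed
  ultimately have "?s \<longlonglongrightarrow> root ?D 0"
    by (rule Lim_transform_eventually)
  hence "?s \<longlonglongrightarrow> 0"
    by simp
  hence s_lim: "filterlim ?s (at_right 0) sequentially"
    by (simp add: filterlim_at)
  have ev: "\<forall>\<^sub>F n in sequentially. \<tau> / h z * (measure \<mu> (nball nrm z (?s n)) / measure (nleb X) (nball nrm z (?s n)))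
      = real n * measure \<mu> (nball nrm z (?s n) \<inter> X)"
  proof -
    obtain \<rho> where \<rho>: "\<rho> > 0" "\<And>r. r \<le> \<rho> \<Longrightarrow> nball nrm z r \<subseteq> \<Lambda> (Suc 0)"
      using nball_subset_open[OF nrm open_Lam[of 0]] z Lam_inf_subset_Lam[of 0] by blast
    have "\<forall>\<^sub>F n in sequentially. ?s n < \<rho>"
      using \<open>?s \<longlonglongrightarrow> 0\<close> \<rho>(1) by (rule order_tendstoD)
    thus ?thesis
      using eventually_ge_at_top[of 1]
    proof eventually_elim
      case (elim n)
      have B: "nball nrm z (?s n) \<inter> X = nball nrm z (?s n)"
        using \<rho>(2)[of "?s n"] elim Lam_subset_X[of "Suc 0"] by auto
      have m: "measure (nleb X) (nball nrm z (?s n)) = \<tau> / h z / real n"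
        using measure_ball[of "?s n"] s_pow elim by simp
      show ?case
        unfolding B m using \<tau> hz elim by (simp add: field_simps)
    qed
  qed
  have lim: "(\<lambda>n. \<tau> / h z * (measure \<mu> (nball nrm z (?s n)) / measure (nleb X) (nball nrm z (?s n))))
      \<longlonglongrightarrow> \<tau> / h z * h z"
    using filterlim_compose[OF \<mu>_density_at_Lam_inf[OF nrm z] s_lim] by (rule tendsto_mult_left)
  have "(\<lambda>n. real n * measure \<mu> (nball nrm z (?s n) \<inter> X)) \<longlonglongrightarrow> \<tau> / h z * h z"
    by (rule Lim_transform_eventually[OF lim ev])
  thus ?thesis
    using hz by simp
qed

text \<open>The event does not involve the noise, so its probability is the \<open>\<mu>\<close>-measure of its section. The centre \<open>z\<close>,
where \<open>Y0\<close> is infinite, belongs to every ball.\<close>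
lemma measure_Y0_gt:
  assumes nrm: "is_norm nrm"
  shows "measure (path_measure X \<epsilon> \<mu>) {p \<in> space (path_measure X \<epsilon> \<mu>). Y0 nrm z (fst p) > ereal u}
    = measure \<mu> (nball nrm z (exp (- u)) \<inter> X)"
proof -
  let ?N = "\<Pi>\<^sub>M i\<in>(UNIV::nat set). theta X \<epsilon>"
  interpret noise: prob_space ?N
    by (intro prob_space_PiM prob_space_theta)
  let ?B = "nball nrm z (exp (- u)) \<inter> X"
  note N = is_normD[OF nrm]
  have dist_pos: "0 < ndist nrm x z" if "x \<noteq> z" for x
    using that N(2)[of "x - z"] N(6)[of "x - z"] by (simp add: ndist_def order_less_le)
  have dist_commute: "ndist nrm z x = ndist nrm x z" for x
    using N(5)[of "x - z"] by (simp add: ndist_def)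
  have Y0: "Y0 nrm z x > ereal u \<longleftrightarrow> x \<in> nball nrm z (exp (- u))" for x
  proof (cases "x = z")
    case True
    thus ?thesis
      by (simp add: Y0_def nball_def ndist_def N(1))
  next
    case False
    hence "Y0 nrm z x > ereal u \<longleftrightarrow> ln (ndist nrm x z) < - u"
      by (auto simp: Y0_def)
    also have "\<dots> \<longleftrightarrow> ndist nrm x z < exp (- u)"
      using dist_pos[OF False] by (metis exp_less_cancel_iff exp_ln)
    finally show ?thesis
      by (simp add: nball_def dist_commute)
  qed
  have event: "{p \<in> space (path_measure X \<epsilon> \<mu>). Y0 nrm z (fst p) > ereal u} = ?B \<times> space ?N"
    by (auto simp: Y0 path_measure_def space_pair_measure space_\<mu>)
  have "?B \<in> sets \<mu>"
    using borel_open[OF open_nball[OF nrm]] X_lebesgue by (simp add: sets_\<mu> sets_unif sets.Int)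
  hence "emeasure (\<mu> \<Otimes>\<^sub>M ?N) (?B \<times> space ?N) = emeasure \<mu> ?B * emeasure ?N (space ?N)"
    by (intro noise.emeasure_pair_measure_Times) auto
  thus ?thesis
    unfolding event by (simp add: path_measure_def measure_def noise.emeasure_space_1)
qed

end

theorem proposition4p3:
  fixes X :: "(real^'n) set" and f :: "real^'n \<Rightarrow> real^'n" and nrm :: "real^'n \<Rightarrow> real"
    and N :: nat and U :: "nat \<Rightarrow> (real^'n) set" and S :: "(real^'n) set"
    and \<epsilon> lam :: real
  assumes "is_norm nrm"
    and "compact X" and "X \<noteq> {}" and "X = closure (interior X)"
    and "\<And>i. i \<in> {1..N} \<Longrightarrow> open (U i)"
    and "\<And>i. i \<in> {1..N} \<Longrightarrow> U i \<subseteq> X"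
    and "disjoint_family_on U {1..N}"
    and "X = (\<Union>i\<in>{1..N}. closure (U i))"
    and "S = singular_set X N U"
    and "emeasure (nleb X) S = 0"
    and "f ` X \<subseteq> X"
    and "non_singular (unif X) f"
    and "inj_on f X"
    and "C1_diffeo_onto_image f (X - S)"
    and "0 < \<epsilon>" and "\<epsilon> < 1"
    and "0 < lam" and "lam < inverse (1 - \<epsilon>)"
    and "\<And>x. x \<in> X - S \<Longrightarrow> inverse \<bar>jacobian f x\<bar> \<le> lam"
  shows "(\<forall>x\<in>Lam_inf X S f. continuous (at x within X) (h_eps X S f \<epsilon>)) \<and>
    (\<forall>\<mu> z \<tau> y a b u.
       acs_prob_measure X f \<epsilon> \<mu> \<longrightarrow> z \<in> Lam_inf X S f \<longrightarrow> \<tau> > 0 \<longrightarrow>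
       y = - ln \<tau> \<longrightarrow>
       (\<forall>n\<ge>1. a n = real CARD('n)) \<longrightarrow>
       (\<forall>n\<ge>1. measure (nleb X) (nball nrm z (exp (- b n))) = 1 / (real n * h_eps X S f \<epsilon> z)) \<longrightarrow>
       (\<forall>n\<ge>1. u n = y / a n + b n) \<longrightarrow>
       (\<lambda>n. real n * measure (path_measure X \<epsilon> \<mu>)
                {p \<in> space (path_measure X \<epsilon> \<mu>). Y0 nrm z (fst p) > ereal (u n)})
         \<longlonglongrightarrow> \<tau>)"
proof -
  have S_sub: "S \<subseteq> X"
    using \<open>S = singular_set X N U\<close> by (auto simp: singular_set_def)
  have f_meas: "f \<in> measurable (unif X) (unif X)"
    using \<open>non_singular (unif X) f\<close> by (simp add: non_singular_def)
  interpret bounded_contraction X S f \<epsilon> lam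
    by unfold_locales (fact S_sub f_meas assms)+
  show ?thesis
  proof (intro conjI ballI allI impI)
    fix x assume "x \<in> Lam_inf X S f"
    thus "continuous (at x within X) h"
      by (rule continuous_h)
  next
    fix \<mu> :: "(real^'n) measure" and z :: "real^'n" and \<tau> y :: real and a b u :: "nat \<Rightarrow> real"
    assume acs: "acs_prob_measure X f \<epsilon> \<mu>" and z: "z \<in> Lam_inf X S f" and \<tau>: "\<tau> > 0"
      and y: "y = - ln \<tau>" and a: "\<forall>n\<ge>1. a n = real CARD('n)"
      and b: "\<forall>n\<ge>1. measure (nleb X) (nball nrm z (exp (- b n))) = 1 / (real n * h z)"
      and u: "\<forall>n\<ge>1. u n = y / a n + b n"
    interpret stationary_perturbation X S f \<epsilon> lam \<mu>
      using acs by unfold_locales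
    show "(\<lambda>n. real n * measure (path_measure X \<epsilon> \<mu>)
        {p \<in> space (path_measure X \<epsilon> \<mu>). Y0 nrm z (fst p) > ereal (u n)}) \<longlonglongrightarrow> \<tau>"
      unfolding measure_Y0_gt[OF \<open>is_norm nrm\<close>]
      using z \<tau> y a b u by (intro n_\<mu>_nball_tendsto \<open>is_norm nrm\<close>) auto
  qed
qed

end
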